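(* Let $p$ be an odd prime, let $\theta$ be a primitive $p$-th root of unity over $\mathbb{Q}_p$, let $\mathcal{O}=\mathbb{Z}_p[\theta]$, and let $G=\mathcal{O}\rtimes C_p$, where a generator $\tau$ of $C_p$ acts on $\mathcal{O}$ as multiplication by $\theta$. Then the Quillen category $\mathscr{A}_p(G/\gamma_i(G))$ is, up to equivalence of categories, independent of $i$ for $i\ge p+1$.
   Context: $\gamma_i(G)$ denotes the $i$-th term of the lower central series of $G$ (with $\gamma_1(G)=G$). For a finite group $H$, the Quillen category $\mathscr{A}_p(H)$ has as objects the elementary abelian $p$-subgroups of $H$ (including the trivial one), and as morphisms $E\to E'$ the injective homomorphisms $x\mapsto hxh^{-1}$ with $h\in H$, $hEh^{-1}\le E'$. *)

theory Defs
  imports "HOL-Algebra.Algebra" "HOL-Computational_Algebra.Primes"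
begin

section \<open>The \<open>p\<close>-adic integers and the \<open>p\<close>-adic numbers\<close>

text \<open>
  \<open>\<int>\<^sub>p\<close> is the inverse limit of the rings \<open>\<int>/p\<^sup>n\<close>: a \<open>p\<close>-adic integer is the compatible sequence of
  its residues, the residue modulo \<open>p ^ n\<close> being represented in \<open>{0..<p ^ n}\<close>.
\<close>

definition padic_int :: "nat \<Rightarrow> (nat \<Rightarrow> int) ring"
  where "padic_int p =
    \<lparr>carrier = {x. \<forall>n. x n \<in> {0..<int p ^ n} \<and> x (Suc n) mod int p ^ n = x n},
     monoid.mult = (\<lambda>x y n. (x n * y n) mod int p ^ n),
     one = (\<lambda>n. 1 mod int p ^ n),
     ring.zero = (\<lambda>n. 0),
     ring.add = (\<lambda>x y n. (x n + y n) mod int p ^ n)\<rparr>"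

text \<open>\<open>fraction R a b\<close> is the fraction \<open>a/b\<close>, i.e. the equivalence class of the pair \<open>(a, b)\<close>.\<close>

definition fraction :: "('a, 'm) ring_scheme \<Rightarrow> 'a \<Rightarrow> 'a \<Rightarrow> ('a \<times> 'a) set"
  where "fraction R a b =
    {(c, d). c \<in> carrier R \<and> d \<in> carrier R - {\<zero>\<^bsub>R\<^esub>} \<and> a \<otimes>\<^bsub>R\<^esub> d = c \<otimes>\<^bsub>R\<^esub> b}"

text \<open>
  The operations take the union over all representatives of the class of the result; over an integral domain
  these classes all coincide.
\<close>

definition fraction_field :: "('a, 'm) ring_scheme \<Rightarrow> ('a \<times> 'a) set ring"
  where "fraction_field R =
    \<lparr>carrier = {fraction R a b | a b. a \<in> carrier R \<and> b \<in> carrier R - {\<zero>\<^bsub>R\<^esub>}},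
     monoid.mult = (\<lambda>A B. \<Union>(a, b)\<in>A. \<Union>(c, d)\<in>B. fraction R (a \<otimes>\<^bsub>R\<^esub> c) (b \<otimes>\<^bsub>R\<^esub> d)),
     one = fraction R \<one>\<^bsub>R\<^esub> \<one>\<^bsub>R\<^esub>,
     ring.zero = fraction R \<zero>\<^bsub>R\<^esub> \<one>\<^bsub>R\<^esub>,
     ring.add = (\<lambda>A B. \<Union>(a, b)\<in>A. \<Union>(c, d)\<in>B.
       fraction R (a \<otimes>\<^bsub>R\<^esub> d \<oplus>\<^bsub>R\<^esub> c \<otimes>\<^bsub>R\<^esub> b) (b \<otimes>\<^bsub>R\<^esub> d))\<rparr>"

definition padic_field :: "nat \<Rightarrow> ((nat \<Rightarrow> int) \<times> (nat \<Rightarrow> int)) set ring"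
  where "padic_field p = fraction_field (padic_int p)"

text \<open>The copy of \<open>\<int>\<^sub>p\<close> inside \<open>\<rat>\<^sub>p\<close>.\<close>

definition padic_integers :: "nat \<Rightarrow> ((nat \<Rightarrow> int) \<times> (nat \<Rightarrow> int)) set set"
  where "padic_integers p = (\<lambda>a. fraction (padic_int p) a \<one>\<^bsub>padic_int p\<^esub>) ` carrier (padic_int p)"

definition primitive_root_of_unity :: "('a, 'm) ring_scheme \<Rightarrow> nat \<Rightarrow> 'a \<Rightarrow> bool"
  where "primitive_root_of_unity R n x \<longleftrightarrow>
    x \<in> carrier R \<and> x [^]\<^bsub>R\<^esub> n = \<one>\<^bsub>R\<^esub> \<and> (\<forall>k. 0 < k \<and> k < n \<longrightarrow> x [^]\<^bsub>R\<^esub> k \<noteq> \<one>\<^bsub>R\<^esub>)"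


section \<open>Semidirect products and the lower central series\<close>

definition semidirect_product ::
    "('a, 'm) monoid_scheme \<Rightarrow> ('b, 'n) monoid_scheme \<Rightarrow> ('b \<Rightarrow> 'a \<Rightarrow> 'a) \<Rightarrow> ('a \<times> 'b) monoid"
  where "semidirect_product N H \<phi> =
    \<lparr>carrier = carrier N \<times> carrier H,
     monoid.mult = (\<lambda>(x, h) (y, k). (x \<otimes>\<^bsub>N\<^esub> \<phi> h y, h \<otimes>\<^bsub>H\<^esub> k)),
     one = (\<one>\<^bsub>N\<^esub>, \<one>\<^bsub>H\<^esub>)\<rparr>"

definition commutator_subgroup ::
    "('a, 'm) monoid_scheme \<Rightarrow> 'a set \<Rightarrow> 'a set \<Rightarrow> 'a set"
  where "commutator_subgroup G A B =
    generate G (\<Union>a\<in>A. \<Union>b\<in>B. {a \<otimes>\<^bsub>G\<^esub> b \<otimes>\<^bsub>G\<^esub> inv\<^bsub>G\<^esub> a \<otimes>\<^bsub>G\<^esub> inv\<^bsub>G\<^esub> b})"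

text \<open>The series is indexed from 1; the value at 0 is irrelevant.\<close>

fun lower_central :: "('a, 'm) monoid_scheme \<Rightarrow> nat \<Rightarrow> 'a set"
  where
    "lower_central G 0 = carrier G"
  | "lower_central G (Suc 0) = carrier G"
  | "lower_central G (Suc (Suc n)) = commutator_subgroup G (lower_central G (Suc n)) (carrier G)"


section \<open>Categories and equivalences of categories\<close>

text \<open>
  Hom-sets need not be disjoint, so composition takes the three objects as arguments:
  \<open>Comp C A B D g f\<close> is the composite of \<open>f : A \<rightarrow> B\<close> and \<open>g : B \<rightarrow> D\<close>.
\<close>

record ('o, 'a) category =
  Obj :: "'o set"
  Hom :: "'o \<Rightarrow> 'o \<Rightarrow> 'a set"
  Id :: "'o \<Rightarrow> 'a"
  Comp :: "'o \<Rightarrow> 'o \<Rightarrow> 'o \<Rightarrow> 'a \<Rightarrow> 'a \<Rightarrow> 'a"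

definition is_category :: "('o, 'a) category \<Rightarrow> bool"
  where "is_category C \<longleftrightarrow>
    (\<forall>A\<in>Obj C. Id C A \<in> Hom C A A) \<and>
    (\<forall>A\<in>Obj C. \<forall>B\<in>Obj C. \<forall>D\<in>Obj C. \<forall>f\<in>Hom C A B. \<forall>g\<in>Hom C B D.
       Comp C A B D g f \<in> Hom C A D) \<and>
    (\<forall>A\<in>Obj C. \<forall>B\<in>Obj C. \<forall>f\<in>Hom C A B.
       Comp C A A B f (Id C A) = f \<and> Comp C A B B (Id C B) f = f) \<and>
    (\<forall>A\<in>Obj C. \<forall>B\<in>Obj C. \<forall>D\<in>Obj C. \<forall>E\<in>Obj C.
       \<forall>f\<in>Hom C A B. \<forall>g\<in>Hom C B D. \<forall>h\<in>Hom C D E.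
         Comp C A D E h (Comp C A B D g f) = Comp C A B E (Comp C B D E h g) f)"

record ('o1, 'a1, 'o2, 'a2) cat_functor =
  on_obj :: "'o1 \<Rightarrow> 'o2"
  on_hom :: "'o1 \<Rightarrow> 'o1 \<Rightarrow> 'a1 \<Rightarrow> 'a2"

definition is_functor ::
    "('o1, 'a1) category \<Rightarrow> ('o2, 'a2) category \<Rightarrow> ('o1, 'a1, 'o2, 'a2) cat_functor \<Rightarrow> bool"
  where "is_functor C D F \<longleftrightarrow>
    (\<forall>A\<in>Obj C. on_obj F A \<in> Obj D) \<and>
    (\<forall>A\<in>Obj C. \<forall>B\<in>Obj C. \<forall>f\<in>Hom C A B.
       on_hom F A B f \<in> Hom D (on_obj F A) (on_obj F B)) \<and>
    (\<forall>A\<in>Obj C. on_hom F A A (Id C A) = Id D (on_obj F A)) \<and>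
    (\<forall>A\<in>Obj C. \<forall>B\<in>Obj C. \<forall>E\<in>Obj C. \<forall>f\<in>Hom C A B. \<forall>g\<in>Hom C B E.
       on_hom F A E (Comp C A B E g f) =
       Comp D (on_obj F A) (on_obj F B) (on_obj F E) (on_hom F B E g) (on_hom F A B f))"

definition id_functor :: "('o, 'a, 'o, 'a) cat_functor"
  where "id_functor = \<lparr>on_obj = (\<lambda>A. A), on_hom = (\<lambda>A B f. f)\<rparr>"

definition comp_functor ::
    "('o2, 'a2, 'o3, 'a3) cat_functor \<Rightarrow> ('o1, 'a1, 'o2, 'a2) cat_functor \<Rightarrow>
     ('o1, 'a1, 'o3, 'a3) cat_functor"
  where "comp_functor G F =
    \<lparr>on_obj = (\<lambda>A. on_obj G (on_obj F A)),
     on_hom = (\<lambda>A B f. on_hom G (on_obj F A) (on_obj F B) (on_hom F A B f))\<rparr>"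

definition is_iso :: "('o, 'a) category \<Rightarrow> 'o \<Rightarrow> 'o \<Rightarrow> 'a \<Rightarrow> bool"
  where "is_iso C A B f \<longleftrightarrow>
    f \<in> Hom C A B \<and>
    (\<exists>g\<in>Hom C B A. Comp C A B A g f = Id C A \<and> Comp C B A B f g = Id C B)"

definition naturally_isomorphic ::
    "('o1, 'a1) category \<Rightarrow> ('o2, 'a2) category \<Rightarrow>
     ('o1, 'a1, 'o2, 'a2) cat_functor \<Rightarrow> ('o1, 'a1, 'o2, 'a2) cat_functor \<Rightarrow> bool"
  where "naturally_isomorphic C D F G \<longleftrightarrow>
    (\<exists>\<eta>. (\<forall>A\<in>Obj C. is_iso D (on_obj F A) (on_obj G A) (\<eta> A)) \<and>
         (\<forall>A\<in>Obj C. \<forall>B\<in>Obj C. \<forall>f\<in>Hom C A B.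
            Comp D (on_obj F A) (on_obj F B) (on_obj G B) (\<eta> B) (on_hom F A B f) =
            Comp D (on_obj F A) (on_obj G A) (on_obj G B) (on_hom G A B f) (\<eta> A)))"

definition equivalent_categories :: "('o1, 'a1) category \<Rightarrow> ('o2, 'a2) category \<Rightarrow> bool"
  where "equivalent_categories C D \<longleftrightarrow>
    is_category C \<and> is_category D \<and>
    (\<exists>F G. is_functor C D F \<and> is_functor D C G \<and>
       naturally_isomorphic C C (comp_functor G F) id_functor \<and>
       naturally_isomorphic D D (comp_functor F G) id_functor)"


section \<open>The Quillen category\<close>

definition elementary_abelian_subgroup :: "nat \<Rightarrow> ('a, 'm) monoid_scheme \<Rightarrow> 'a set \<Rightarrow> bool"
  where "elementary_abelian_subgroup p H E \<longleftrightarrow>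
    subgroup E H \<and> comm_group (H\<lparr>carrier := E\<rparr>) \<and> (\<forall>x\<in>E. x [^]\<^bsub>H\<^esub> p = \<one>\<^bsub>H\<^esub>)"

text \<open>
  A morphism out of \<open>E\<close> is a map, not a conjugating element: it is made extensional on \<open>E\<close>, so that
  elements of \<open>H\<close> that act alike on \<open>E\<close> give the same morphism.
\<close>

definition quillen_category :: "nat \<Rightarrow> ('a, 'm) monoid_scheme \<Rightarrow> ('a set, 'a \<Rightarrow> 'a) category"
  where "quillen_category p H =
    \<lparr>Obj = {E. elementary_abelian_subgroup p H E},
     Hom = (\<lambda>E E'. {restrict (\<lambda>x. h \<otimes>\<^bsub>H\<^esub> x \<otimes>\<^bsub>H\<^esub> inv\<^bsub>H\<^esub> h) E | h.
       h \<in> carrier H \<and> (\<lambda>x. h \<otimes>\<^bsub>H\<^esub> x \<otimes>\<^bsub>H\<^esub> inv\<^bsub>H\<^esub> h) ` E \<subseteq> E'}),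
     Id = (\<lambda>E. restrict (\<lambda>x. x) E),
     Comp = (\<lambda>E E' E'' g f. compose E g f)\<rparr>"

end

theory Submission
  imports Defs
begin

text \<open>
  Put \<open>\<pi> = \<theta> - 1\<close>.  Then \<open>\<gamma>\<^sub>i(G) = \<pi>\<^sup>i\<^sup>-\<^sup>1\<O>\<close> for \<open>i \<ge> 2\<close>, and \<open>p\<close> is associated to \<open>\<pi>\<^sup>p\<^sup>-\<^sup>1\<close>, so with \<open>c = i - p\<close>
  the \<open>p\<close>-torsion of \<open>\<O>/\<pi>\<^sup>i\<^sup>-\<^sup>1\<O>\<close> is \<open>\<pi>\<^sup>c\<O>/\<pi>\<^sup>i\<^sup>-\<^sup>1\<O>\<close>, a copy of \<open>\<O>/\<pi>\<^sup>p\<^sup>-\<^sup>1\<O>\<close> as a \<open>C\<^sub>p\<close>-module.  An elementary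
  abelian subgroup either lies in it or is generated by an element \<open>(x, \<tau>)\<close> and a subgroup of its socle
  \<open>\<pi>\<^sup>i\<^sup>-\<^sup>2\<O>/\<pi>\<^sup>i\<^sup>-\<^sup>1\<O>\<close>; the elements \<open>(x, \<tau>)\<close> are classified up to conjugacy by \<open>x\<close> modulo \<open>\<pi>\<close>.  After division
  by \<open>\<pi>\<^sup>c\<close> neither the subgroups nor the maps that conjugation induces between them involve \<open>i\<close>, which
  gives the equivalence.
\<close>

section \<open>Equivalences from compatible presentations of two categories\<close>

text \<open>The threshold i \<ge> p + 1 says c \<ge> 1. Then \<pi>^c lies in (\<pi>), so a change of
  x by an element of \<pi>^c \<O> does not affect its class modulo \<pi>, the only invariant of x
  under conjugation. The obstacle is that parameters are not unique, and that their ambiguity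
  depends on i: a subgroup determines its x only modulo \<pi>^c S, and not at all when it lies in
  the torsion. Matching parameters therefore does not give a well-defined map on subgroups. Instead
  one set of parameters is mapped onto the objects of both categories, and only the hom-sets are
  matched, bijectively and compatibly with composition. Choosing a parameter for every object then
  gives functors in both directions that are inverse up to natural isomorphism.\<close>

locale category_span =
  fixes C :: "('o1, 'a1) category" and D :: "('o2, 'a2) category"
    and T :: "'t set" and A :: "'t \<Rightarrow> 'o1" and B :: "'t \<Rightarrow> 'o2"
    and \<beta> :: "'t \<Rightarrow> 't \<Rightarrow> 'a1 \<Rightarrow> 'a2" and \<beta>' :: "'t \<Rightarrow> 't \<Rightarrow> 'a2 \<Rightarrow> 'a1"
  assumes cat_C: "is_category C" and cat_D: "is_category D"
    and A_img: "A ` T = Obj C" and B_img: "B ` T = Obj D"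
    and \<beta>_hom: "\<And>s t f. s \<in> T \<Longrightarrow> t \<in> T \<Longrightarrow> f \<in> Hom C (A s) (A t) \<Longrightarrow>
      \<beta> s t f \<in> Hom D (B s) (B t) \<and> \<beta>' s t (\<beta> s t f) = f"
    and \<beta>'_hom: "\<And>s t f. s \<in> T \<Longrightarrow> t \<in> T \<Longrightarrow> f \<in> Hom D (B s) (B t) \<Longrightarrow>
      \<beta>' s t f \<in> Hom C (A s) (A t) \<and> \<beta> s t (\<beta>' s t f) = f"
    and \<beta>_Id: "\<And>t. t \<in> T \<Longrightarrow> \<beta> t t (Id C (A t)) = Id D (B t)"
    and \<beta>_Comp: "\<And>r s t f g. r \<in> T \<Longrightarrow> s \<in> T \<Longrightarrow> t \<in> T \<Longrightarrow>
      f \<in> Hom C (A r) (A s) \<Longrightarrow> g \<in> Hom C (A s) (A t) \<Longrightarrow>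
      \<beta> r t (Comp C (A r) (A s) (A t) g f) = Comp D (B r) (B s) (B t) (\<beta> s t g) (\<beta> r s f)"
begin

lemma A_Obj: "t \<in> T \<Longrightarrow> A t \<in> Obj C" and B_Obj: "t \<in> T \<Longrightarrow> B t \<in> Obj D"
  using A_img B_img by auto

lemma Id_C: "t \<in> T \<Longrightarrow> Id C (A t) \<in> Hom C (A t) (A t)"
  using cat_C A_Obj by (simp add: is_category_def)

lemma Id_D: "t \<in> T \<Longrightarrow> Id D (B t) \<in> Hom D (B t) (B t)"
  using cat_D B_Obj by (simp add: is_category_def)

lemma Comp_C: "r \<in> T \<Longrightarrow> s \<in> T \<Longrightarrow> t \<in> T \<Longrightarrow> f \<in> Hom C (A r) (A s) \<Longrightarrow> g \<in> Hom C (A s) (A t) \<Longrightarrow>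
    Comp C (A r) (A s) (A t) g f \<in> Hom C (A r) (A t)"
  using cat_C A_Obj unfolding is_category_def by blast

lemma Comp_D: "r \<in> T \<Longrightarrow> s \<in> T \<Longrightarrow> t \<in> T \<Longrightarrow> f \<in> Hom D (B r) (B s) \<Longrightarrow> g \<in> Hom D (B s) (B t) \<Longrightarrow>
    Comp D (B r) (B s) (B t) g f \<in> Hom D (B r) (B t)"
  using cat_D B_Obj unfolding is_category_def by blast

lemma Comp_Id_D:
  assumes "s \<in> T" "t \<in> T" "f \<in> Hom D (B s) (B t)"
  shows "Comp D (B s) (B s) (B t) f (Id D (B s)) = f" "Comp D (B s) (B t) (B t) (Id D (B t)) f = f"
  using cat_D B_Obj[OF assms(1)] B_Obj[OF assms(2)] assms(3) unfolding is_category_def by blast+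

lemma \<beta>_inj:
  assumes "s \<in> T" "t \<in> T" "f \<in> Hom C (A s) (A t)" "g \<in> Hom C (A s) (A t)" "\<beta> s t f = \<beta> s t g"
  shows "f = g"
  using \<beta>_hom assms by metis

text \<open>The locale asks for functoriality of \<open>\<beta>\<close> alone. As
  \<open>\<beta>\<close> is injective on each hom-set, an identity for \<open>\<beta>'\<close> can
  be checked after applying \<open>\<beta>\<close>. The symmetry halves the work: every result below
  is used in both directions.\<close>

lemma flip: "category_span D C T B A \<beta>' \<beta>"
proof
  fix t assume "t \<in> T"
  then show "\<beta>' t t (Id D (B t)) = Id C (A t)"
    using \<beta>_hom \<beta>_Id Id_C by metis
next
  fix r s t f g
  assume *: "r \<in> T" "s \<in> T" "t \<in> T" "f \<in> Hom D (B r) (B s)" "g \<in> Hom D (B s) (B t)"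
  show "\<beta>' r t (Comp D (B r) (B s) (B t) g f) = Comp C (A r) (A s) (A t) (\<beta>' s t g) (\<beta>' r s f)"
  proof (rule \<beta>_inj[of r t])
    show "\<beta> r t (\<beta>' r t (Comp D (B r) (B s) (B t) g f)) =
        \<beta> r t (Comp C (A r) (A s) (A t) (\<beta>' s t g) (\<beta>' r s f))"
      using * \<beta>_Comp[of r s t "\<beta>' r s f" "\<beta>' s t g"] \<beta>'_hom Comp_D by simp
  qed (use * \<beta>'_hom Comp_D Comp_C in auto)
qed (use cat_C cat_D A_img B_img \<beta>_hom \<beta>'_hom in auto)

text \<open>\<open>s\<close> is a choice of parameters, meant to be a section of \<open>A\<close>;
  different choices give different functors.\<close>

definition transport :: "('o1 \<Rightarrow> 't) \<Rightarrow> ('o1, 'a1, 'o2, 'a2) cat_functor"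
  where "transport s = \<lparr>on_obj = (\<lambda>U. B (s U)), on_hom = (\<lambda>U V. \<beta> (s U) (s V))\<rparr>"

lemma transport_functor:
  assumes s: "\<And>U. U \<in> Obj C \<Longrightarrow> s U \<in> T \<and> A (s U) = U"
  shows "is_functor C D (transport s)"
  unfolding is_functor_def transport_def
proof (intro conjI ballI; simp)
  fix U assume "U \<in> Obj C" then show "B (s U) \<in> Obj D"
    "\<beta> (s U) (s U) (Id C U) = Id D (B (s U))"
    using s B_Obj \<beta>_Id[of "s U"] by auto
next
  fix U V f assume "U \<in> Obj C" "V \<in> Obj C" "f \<in> Hom C U V"
  then show "\<beta> (s U) (s V) f \<in> Hom D (B (s U)) (B (s V))"
    using s \<beta>_hom[of "s U" "s V" f] by simp
next
  fix U V W f g assume "U \<in> Obj C" "V \<in> Obj C" "W \<in> Obj C" "f \<in> Hom C U V" "g \<in> Hom C V W"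
  then show "\<beta> (s U) (s W) (Comp C U V W g f) =
      Comp D (B (s U)) (B (s V)) (B (s W)) (\<beta> (s V) (s W) g) (\<beta> (s U) (s V) f)"
    using s \<beta>_Comp[of "s U" "s V" "s W" f g] by simp
qed

text \<open>The round trip takes \<open>U\<close> to \<open>A u\<close> with
  \<open>u = r (B (s U))\<close>. The parameters \<open>u\<close> and \<open>s U\<close> present the
  same object of \<open>D\<close>, so the identity of that object, read back in \<open>C\<close>, is
  an isomorphism from \<open>A u\<close> to \<open>U\<close>.\<close>

lemma transport_natural:
  assumes s: "\<And>U. U \<in> Obj C \<Longrightarrow> s U \<in> T \<and> A (s U) = U"
    and r: "\<And>V. V \<in> Obj D \<Longrightarrow> r V \<in> T \<and> B (r V) = V"
  shows "naturally_isomorphic C C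
    (comp_functor (category_span.transport A \<beta>' r) (transport s)) id_functor"
proof -
  interpret flip: category_span D C T B A \<beta>' \<beta> by (rule flip)
  let ?u = "\<lambda>U. r (B (s U))"
  let ?\<eta> = "\<lambda>U. \<beta>' (?u U) (s U) (Id D (B (s U)))"
  have u: "?u U \<in> T" "B (?u U) = B (s U)" "s U \<in> T" "A (s U) = U" if "U \<in> Obj C" for U
    using that s r B_Obj by auto
  have \<eta>: "?\<eta> U \<in> Hom C (A (?u U)) U" "\<beta> (?u U) (s U) (?\<eta> U) = Id D (B (s U))"
    if "U \<in> Obj C" for U
    using \<beta>'_hom[of "?u U" "s U" "Id D (B (s U))"] u[OF that] Id_D[of "s U"] by auto
  show ?thesis
    unfolding naturally_isomorphic_def comp_functor_def transport_def flip.transport_def id_functor_def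
      is_iso_def cat_functor.simps
  proof (intro exI[of _ ?\<eta>] conjI ballI)
    fix U assume U: "U \<in> Obj C"
    note u = u[OF U] and \<eta> = \<eta>[OF U]
    show "?\<eta> U \<in> Hom C (A (?u U)) U" by fact
    \<comment> \<open>The same identity of \<open>D\<close>, read back in the opposite direction, is
      the inverse.\<close>
    let ?\<zeta> = "\<beta>' (s U) (?u U) (Id D (B (s U)))"
    have \<zeta>: "?\<zeta> \<in> Hom C U (A (?u U))" "\<beta> (s U) (?u U) ?\<zeta> = Id D (B (s U))"
      using \<beta>'_hom[of "s U" "?u U" "Id D (B (s U))"] u Id_D[of "s U"] by auto
    have I: "Comp D (B (s U)) (B (s U)) (B (s U)) (Id D (B (s U))) (Id D (B (s U))) = Id D (B (s U))"
      using Comp_Id_D Id_D u by blast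
    show "\<exists>g\<in>Hom C U (A (?u U)). Comp C (A (?u U)) U (A (?u U)) g (?\<eta> U) = Id C (A (?u U)) \<and>
        Comp C U (A (?u U)) U (?\<eta> U) g = Id C U"
    proof (intro bexI[of _ ?\<zeta>] conjI \<zeta>)
      show "Comp C (A (?u U)) U (A (?u U)) ?\<zeta> (?\<eta> U) = Id C (A (?u U))"
        using \<beta>_inj[of "?u U" "?u U", OF _ _ Comp_C[of "?u U" "s U" "?u U" "?\<eta> U" ?\<zeta>] Id_C]
          \<beta>_Comp[of "?u U" "s U" "?u U" "?\<eta> U" ?\<zeta>] u \<eta> \<zeta> I \<beta>_Id[of "?u U"] by simp
      show "Comp C U (A (?u U)) U (?\<eta> U) ?\<zeta> = Id C U"
        using \<beta>_inj[of "s U" "s U", OF _ _ Comp_C[of "s U" "?u U" "s U" ?\<zeta> "?\<eta> U"] Id_C]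
          \<beta>_Comp[of "s U" "?u U" "s U" ?\<zeta> "?\<eta> U"] u \<eta> \<zeta> I \<beta>_Id[of "s U"] by simp
    qed
  next
    fix U V f assume U: "U \<in> Obj C" and V: "V \<in> Obj C" and f: "f \<in> Hom C U V"
    note uX = u[OF U] and \<eta>U = \<eta>[OF U] and uY = u[OF V] and \<eta>V = \<eta>[OF V]
    let ?h = "\<beta>' (?u U) (?u V) (\<beta> (s U) (s V) f)"
    have F: "\<beta> (s U) (s V) f \<in> Hom D (B (s U)) (B (s V))"
      using \<beta>_hom uX uY f by simp
    have h: "?h \<in> Hom C (A (?u U)) (A (?u V))" "\<beta> (?u U) (?u V) ?h = \<beta> (s U) (s V) f"
      using \<beta>'_hom[of "?u U" "?u V" "\<beta> (s U) (s V) f"] uX uY F by auto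
    show "Comp C (A (?u U)) (A (?u V)) V (?\<eta> V) ?h = Comp C (A (?u U)) U V f (?\<eta> U)"
      using \<beta>_inj[of "?u U" "s V", OF _ _ Comp_C[of "?u U" "?u V" "s V" ?h "?\<eta> V"]
            Comp_C[of "?u U" "s U" "s V" "?\<eta> U" f]]
        \<beta>_Comp[of "?u U" "?u V" "s V" ?h "?\<eta> V"] \<beta>_Comp[of "?u U" "s U" "s V" "?\<eta> U" f]
        uX uY \<eta>U \<eta>V h f Comp_Id_D[of "s U" "s V", OF _ _ F] by simp
  qed
qed

lemma equivalent: "equivalent_categories C D"
proof -
  interpret flip: category_span D C T B A \<beta>' \<beta> by (rule flip)
  obtain s where s: "\<And>U. U \<in> Obj C \<Longrightarrow> s U \<in> T \<and> A (s U) = U"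
    using A_img by (metis image_iff)
  obtain r where r: "\<And>V. V \<in> Obj D \<Longrightarrow> r V \<in> T \<and> B (r V) = V"
    using B_img by (metis image_iff)
  show ?thesis
    unfolding equivalent_categories_def
    using cat_C cat_D transport_functor[of s, OF s] flip.transport_functor[of r, OF r]
      transport_natural[of s r, OF s r] flip.transport_natural[of r s, OF r s] by blast
qed

end

section \<open>Quillen categories presented by parametrized subgroups\<close>

lemma (in group) quillen_is_category: "is_category (quillen_category p G)"
proof -
  let ?C = "quillen_category p G"
  have sub: "E \<subseteq> carrier G" if "E \<in> Obj ?C" for E
    using that by (auto simp: quillen_category_def elementary_abelian_subgroup_def subgroup_def)
  have Hom: "f \<in> Hom ?C E E' \<longleftrightarrow> (\<exists>h\<in>carrier G. f = restrict (\<lambda>x. h \<otimes> x \<otimes> inv h) E \<and>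
      (\<forall>x\<in>E. h \<otimes> x \<otimes> inv h \<in> E'))" for f E E'
    by (auto simp: quillen_category_def)
  have conj: "k \<otimes> (h \<otimes> x \<otimes> inv h) \<otimes> inv k = (k \<otimes> h) \<otimes> x \<otimes> inv (k \<otimes> h)"
    if "k \<in> carrier G" "h \<in> carrier G" "x \<in> carrier G" for h k x
    using that by (simp add: inv_mult_group m_assoc)
  have maps: "f x \<in> E'" if "f \<in> Hom ?C E E'" "x \<in> E" for f E E' x
    using that by (auto simp: Hom)
  have ext: "f \<in> extensional E" if "f \<in> Hom ?C E E'" for f E E'
    using that by (auto simp: Hom)
  have Id: "Id ?C E = restrict (\<lambda>x. x) E" for E by (simp add: quillen_category_def)
  have Comp: "Comp ?C E E' E'' g f = compose E g f" for E E' E'' f g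
    by (simp add: quillen_category_def)
  show ?thesis
    unfolding is_category_def Id Comp
  proof (intro conjI ballI)
    fix E assume "E \<in> Obj ?C"
    from sub[OF this] show "restrict (\<lambda>x. x) E \<in> Hom ?C E E"
      unfolding Hom by (intro bexI[of _ \<one>]) (auto intro!: restrict_ext simp: subset_iff)
  next
    fix A B E f g
    assume A: "A \<in> Obj ?C" and f: "f \<in> Hom ?C A B" and g: "g \<in> Hom ?C B E"
    then obtain h k where h: "h \<in> carrier G" "f = restrict (\<lambda>x. h \<otimes> x \<otimes> inv h) A"
        "\<And>x. x \<in> A \<Longrightarrow> h \<otimes> x \<otimes> inv h \<in> B"
      and k: "k \<in> carrier G" "g = restrict (\<lambda>x. k \<otimes> x \<otimes> inv k) B"
        "\<And>x. x \<in> B \<Longrightarrow> k \<otimes> x \<otimes> inv k \<in> E"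
      unfolding Hom by blast
    show "compose A g f \<in> Hom ?C A E"
      unfolding Hom
    proof (intro bexI[of _ "k \<otimes> h"] conjI ballI)
      show "compose A g f = (\<lambda>x\<in>A. k \<otimes> h \<otimes> x \<otimes> inv (k \<otimes> h))"
        using h k conj[OF k(1) h(1)] sub[OF A] by (auto simp: compose_def intro!: restrict_ext)
      show "k \<otimes> h \<otimes> x \<otimes> inv (k \<otimes> h) \<in> E" if "x \<in> A" for x
        using k(3)[OF h(3)[OF that]] conj[OF k(1) h(1)] sub[OF A] that by auto
    qed (use h k in simp)
  next
    fix A B f assume f: "f \<in> Hom ?C A B"
    show "compose A f (restrict (\<lambda>x. x) A) = f" "compose A (restrict (\<lambda>x. x) B) f = f"
      using ext[OF f] maps[OF f] by (auto simp: compose_def extensional_def fun_eq_iff)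
  next
    fix A B D E f g h assume f: "f \<in> Hom ?C A B"
    show "compose A h (compose A g f) = compose A (compose B h g) f"
      using maps[OF f] by (auto simp: compose_def fun_eq_iff)
  qed
qed

text \<open>The map that \<open>f\<close> becomes when both ends are rewritten from \<open>e\<close>
  to \<open>e'\<close>. It goes through arbitrarily chosen parameters, and is restricted because
  morphisms of the Quillen category are extensional.\<close>

definition transport_map ::
    "('t \<Rightarrow> 'c set) \<Rightarrow> ('t \<Rightarrow> 'c \<Rightarrow> 'x) \<Rightarrow> ('t \<Rightarrow> 'c \<Rightarrow> 'y) \<Rightarrow> 't \<Rightarrow> 't \<Rightarrow> ('x \<Rightarrow> 'x) \<Rightarrow> 'y \<Rightarrow> 'y"
  where "transport_map P e e' s t f = (\<lambda>y\<in>e' s ` P s.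
    e' t (inv_into (P t) (e t) (f (e s (inv_into (P s) (e' s) y)))))"

text \<open>The parameters picked by \<open>inv_into\<close> need not be \<open>a\<close> and
  \<open>m a\<close>, but \<open>e\<close> and \<open>e'\<close> identify the same parameters, so
  the choice has no effect on the value.\<close>

lemma transport_map_apply:
  assumes eq_s: "\<And>a b. a \<in> P s \<Longrightarrow> b \<in> P s \<Longrightarrow> e s a = e s b \<longleftrightarrow> e' s a = e' s b"
    and eq_t: "\<And>a b. a \<in> P t \<Longrightarrow> b \<in> P t \<Longrightarrow> e t a = e t b \<longleftrightarrow> e' t a = e' t b"
    and m: "\<And>a. a \<in> P s \<Longrightarrow> m a \<in> P t" "\<And>a. a \<in> P s \<Longrightarrow> f (e s a) = e t (m a)"
    and a: "a \<in> P s"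
  shows "transport_map P e e' s t f (e' s a) = e' t (m a)"
proof -
  let ?b = "inv_into (P s) (e' s) (e' s a)" and ?d = "inv_into (P t) (e t) (e t (m a))"
  have b: "?b \<in> P s" "e' s ?b = e' s a"
    using a by (auto intro: inv_into_into f_inv_into_f)
  then have "f (e s ?b) = e t (m a)"
    using eq_s[of ?b a] a m by simp
  moreover have d: "?d \<in> P t" "e t ?d = e t (m a)"
    using m a by (auto intro: inv_into_into f_inv_into_f)
  then have "e' t ?d = e' t (m a)"
    using eq_t[of ?d "m a"] m a by simp
  ultimately show ?thesis
    using a by (simp add: transport_map_def)
qed

text \<open>
  The objects are presented by parametrizations, \<open>e\<close> in the first group and \<open>e'\<close> in the second, and
  \<open>M s t\<close> consists of the maps between parameters that induce morphisms.
\<close>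

lemma quillen_equivalentI:
  fixes P :: "'t \<Rightarrow> 'c set" and M :: "'t \<Rightarrow> 't \<Rightarrow> ('c \<Rightarrow> 'c) set"
  assumes "group H" "group K"
    and objH: "(\<lambda>t. e t ` P t) ` T = Obj (quillen_category p H)"
    and objK: "(\<lambda>t. e' t ` P t) ` T = Obj (quillen_category p K)"
    and eq: "\<And>t a b. t \<in> T \<Longrightarrow> a \<in> P t \<Longrightarrow> b \<in> P t \<Longrightarrow> e t a = e t b \<longleftrightarrow> e' t a = e' t b"
    and M: "\<And>s t m a. m \<in> M s t \<Longrightarrow> a \<in> P s \<Longrightarrow> m a \<in> P t"
    and homH: "\<And>s t f. s \<in> T \<Longrightarrow> t \<in> T \<Longrightarrow>
      f \<in> Hom (quillen_category p H) (e s ` P s) (e t ` P t) \<longleftrightarrow>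
      f \<in> extensional (e s ` P s) \<and> (\<exists>m\<in>M s t. \<forall>a\<in>P s. f (e s a) = e t (m a))"
    and homK: "\<And>s t f. s \<in> T \<Longrightarrow> t \<in> T \<Longrightarrow>
      f \<in> Hom (quillen_category p K) (e' s ` P s) (e' t ` P t) \<longleftrightarrow>
      f \<in> extensional (e' s ` P s) \<and> (\<exists>m\<in>M s t. \<forall>a\<in>P s. f (e' s a) = e' t (m a))"
  shows "equivalent_categories (quillen_category p H) (quillen_category p K)"
proof -
  let ?C = "quillen_category p H" and ?D = "quillen_category p K"
  let ?A = "\<lambda>t. e t ` P t" and ?B = "\<lambda>t. e' t ` P t"
  let ?\<beta> = "transport_map P e e'" and ?\<beta>' = "transport_map P e' e"
  have \<beta>: "?\<beta> s t f (e' s a) = e' t (m a)"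
    if "s \<in> T" "t \<in> T" "m \<in> M s t" "\<forall>a\<in>P s. f (e s a) = e t (m a)" "a \<in> P s" for s t f m a
    by (rule transport_map_apply) (use that eq M in auto)
  have \<beta>': "?\<beta>' s t f (e s a) = e t (m a)"
    if "s \<in> T" "t \<in> T" "m \<in> M s t" "\<forall>a\<in>P s. f (e' s a) = e' t (m a)" "a \<in> P s" for s t f m a
    by (rule transport_map_apply) (use that eq M in auto)
  have ext: "?\<beta> s t f \<in> extensional (?B s)" "?\<beta>' s t g \<in> extensional (?A s)" for s t f g
    by (simp_all add: transport_map_def)
  interpret category_span ?C ?D T ?A ?B ?\<beta> ?\<beta>'
  proof
    fix s t f assume st: "s \<in> T" "t \<in> T" and "f \<in> Hom ?C (?A s) (?A t)"
    then obtain m where f: "f \<in> extensional (?A s)" and m: "m \<in> M s t" "\<forall>a\<in>P s. f (e s a) = e t (m a)"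
      using homH by auto
    have *: "\<forall>a\<in>P s. ?\<beta> s t f (e' s a) = e' t (m a)"
      using \<beta>[OF st m] by blast
    then have "?\<beta> s t f \<in> Hom ?D (?B s) (?B t)"
      using homK[OF st] ext m by blast
    \<comment> \<open>One \<open>m\<close> describes both \<open>f\<close> and its transport, so the
      two extensional maps agree on the subgroup.\<close>
    moreover have "?\<beta>' s t (?\<beta> s t f) = f"
      using \<beta>'[OF st m(1) *] m(2) by (intro extensionalityI[OF ext(2) f]) auto
    ultimately show "?\<beta> s t f \<in> Hom ?D (?B s) (?B t) \<and> ?\<beta>' s t (?\<beta> s t f) = f" ..
  next
    fix s t f assume st: "s \<in> T" "t \<in> T" and "f \<in> Hom ?D (?B s) (?B t)"
    then obtain m where f: "f \<in> extensional (?B s)" and m: "m \<in> M s t" "\<forall>a\<in>P s. f (e' s a) = e' t (m a)"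
      using homK by auto
    have *: "\<forall>a\<in>P s. ?\<beta>' s t f (e s a) = e t (m a)"
      using \<beta>'[OF st m] by blast
    then have "?\<beta>' s t f \<in> Hom ?C (?A s) (?A t)"
      using homH[OF st] ext m by blast
    moreover have "?\<beta> s t (?\<beta>' s t f) = f"
      using \<beta>[OF st m(1) *] m(2) by (intro extensionalityI[OF ext(1) f]) auto
    ultimately show "?\<beta>' s t f \<in> Hom ?C (?A s) (?A t) \<and> ?\<beta> s t (?\<beta>' s t f) = f" ..
  next
    fix t assume t: "t \<in> T"
    have "transport_map P e e' t t (Id ?C (?A t)) (e' t a) = e' t a" if "a \<in> P t" for a
      by (rule transport_map_apply[where m = id, simplified])
        (use t eq that in \<open>auto simp: quillen_category_def\<close>)
    then show "?\<beta> t t (Id ?C (?A t)) = Id ?D (?B t)"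
      by (intro extensionalityI[OF ext(1)]) (auto simp: quillen_category_def)
  next
    fix r s t f g
    assume rst: "r \<in> T" "s \<in> T" "t \<in> T"
      and "f \<in> Hom ?C (?A r) (?A s)" "g \<in> Hom ?C (?A s) (?A t)"
    then obtain m n where m: "m \<in> M r s" "\<forall>a\<in>P r. f (e r a) = e s (m a)"
      and n: "n \<in> M s t" "\<forall>a\<in>P s. g (e s a) = e t (n a)"
      using homH by metis
    have "?\<beta> r t (compose (?A r) g f) (e' r a) = e' t (n (m a))" if "a \<in> P r" for a
      by (rule transport_map_apply[where m = "\<lambda>a. n (m a)"])
        (use rst eq that m n M in \<open>auto simp: compose_def\<close>)
    moreover have "?\<beta> r s f (e' r a) = e' s (m a)" if "a \<in> P r" for a
      using \<beta>[OF rst(1,2) m that] .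
    moreover have "?\<beta> s t g (e' s a) = e' t (n a)" if "a \<in> P s" for a
      using \<beta>[OF rst(2,3) n that] .
    ultimately show "?\<beta> r t (Comp ?C (?A r) (?A s) (?A t) g f) =
        Comp ?D (?B r) (?B s) (?B t) (?\<beta> s t g) (?\<beta> r s f)"
      using M[OF m(1)] ext(1)[of r t] unfolding quillen_category_def
      by (intro extensionalityI[of _ "?B r"]) (auto simp: compose_def)
  qed (use objH objK assms(1,2) group.quillen_is_category in auto)
  show ?thesis by (rule equivalent)
qed

section \<open>The ring of \<open>p\<close>-adic integers\<close>

lemma padic_intD:
  assumes "x \<in> carrier (padic_int p)"
  shows "0 \<le> x n" "x n mod int p ^ n = x n" "x (Suc n) mod int p ^ n = x n"
  using assms by (auto simp: padic_int_def)

lemma padic_int_mod_le: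
  assumes x: "x \<in> carrier (padic_int p)" and "m \<le> n"
  shows "x n mod int p ^ m = x m"
  using \<open>m \<le> n\<close>
proof (induction n rule: dec_induct)
  case base
  show ?case by (rule padic_intD[OF x])
next
  case (step n)
  have "x (Suc n) mod int p ^ m = x (Suc n) mod int p ^ n mod int p ^ m"
    using step.hyps by (simp add: mod_mod_cancel le_imp_power_dvd)
  then show ?case using step padic_intD[OF x] by simp
qed

text \<open>Sums, products and negatives are all residues of an integer sequence, so closure under
  each operation reduces to a congruence between consecutive terms.\<close>

lemma padic_int_residues:
  assumes "p > 0" and f: "\<And>n. f (Suc n) mod int p ^ n = f n mod int p ^ n"
  shows "(\<lambda>n. f n mod int p ^ n) \<in> carrier (padic_int p)"
proof -
  have "f (Suc n) mod int p ^ Suc n mod int p ^ n = f n mod int p ^ n" for n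
    by (subst mod_mod_cancel) (auto simp: f)
  with assms(1) show ?thesis by (auto simp: padic_int_def)
qed

lemma padic_int_cring:
  assumes "p > 0"
  shows "cring (padic_int p)"
proof -
  let ?Z = "padic_int p"
  have ops: "x \<otimes>\<^bsub>?Z\<^esub> y = (\<lambda>n. (x n * y n) mod int p ^ n)" "x \<oplus>\<^bsub>?Z\<^esub> y = (\<lambda>n. (x n + y n) mod int p ^ n)"
    "\<one>\<^bsub>?Z\<^esub> = (\<lambda>n. 1 mod int p ^ n)" "\<zero>\<^bsub>?Z\<^esub> = (\<lambda>n. 0 mod int p ^ n)" for x y
    by (simp_all add: padic_int_def)
  have mult: "(x (Suc n) * y (Suc n)) mod int p ^ n = (x n * y n) mod int p ^ n"
    and add: "(x (Suc n) + y (Suc n)) mod int p ^ n = (x n + y n) mod int p ^ n"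
    and minus: "(- x (Suc n)) mod int p ^ n = (- x n) mod int p ^ n"
    if "x \<in> carrier ?Z" "y \<in> carrier ?Z" for x y n
    using that by (metis padic_intD(3) mod_mult_eq, metis padic_intD(3) mod_add_eq, metis padic_intD(3) mod_minus_eq)
  show ?thesis
  proof (intro cringI abelian_groupI comm_monoidI)
    fix x assume x: "x \<in> carrier ?Z"
    show "\<exists>y\<in>carrier ?Z. y \<oplus>\<^bsub>?Z\<^esub> x = \<zero>\<^bsub>?Z\<^esub>"
      using x minus[OF x x] by (intro bexI[of _ "\<lambda>n. (- x n) mod int p ^ n"] padic_int_residues assms)
        (auto simp: ops mod_simps)
  qed (use padic_int_residues[OF assms, of "\<lambda>_. 0"] in
      \<open>auto simp: ops mod_simps padic_intD algebra_simps mult add assms intro!: padic_int_residues\<close>)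
qed

text \<open>Let x be nonzero modulo p^m and y modulo p^n. If xy = 0, then p^(m+n) divides the
  product of the residues at level m + n, so p^a divides one and p^b the other with a + b = m + n.
  But a < m and b < n.\<close>

lemma padic_int_domain:
  assumes p: "Factorial_Ring.prime p"
  shows "domain (padic_int p)"
proof -
  let ?Z = "padic_int p"
  have p1: "p > 1" using p prime_gt_1_nat by blast
  interpret cring ?Z using p1 by (intro padic_int_cring) simp
  have p': "Factorial_Ring.prime_elem (int p)" using p by simp
  show ?thesis
  proof
    \<comment> \<open>Modulo p^0 everything is 0, so 1 and 0 are first told apart at level
      1.\<close>
    have "1 mod int p ^ 1 \<noteq> 0" using p1 by simp
    then show "\<one>\<^bsub>?Z\<^esub> \<noteq> \<zero>\<^bsub>?Z\<^esub>"
      unfolding padic_int_def by (simp add: fun_eq_iff exI[of _ 1])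
  next
    fix x y assume x: "x \<in> carrier ?Z" and y: "y \<in> carrier ?Z" and xy: "x \<otimes>\<^bsub>?Z\<^esub> y = \<zero>\<^bsub>?Z\<^esub>"
    show "x = \<zero>\<^bsub>?Z\<^esub> \<or> y = \<zero>\<^bsub>?Z\<^esub>"
    proof (rule ccontr)
      assume "\<not> ?thesis"
      then obtain m n where m: "x m \<noteq> 0" and n: "y n \<noteq> 0"
        by (auto simp: padic_int_def fun_eq_iff)
      have "(x (m + n) * y (m + n)) mod int p ^ (m + n) = 0"
        using fun_cong[OF xy, of "m + n"] by (simp add: padic_int_def)
      then obtain a b where ab: "a + b = m + n" "int p ^ a dvd x (m + n)" "int p ^ b dvd y (m + n)"
        using prime_elem_power_dvd_prod[OF _ p', of "m + n" "x (m + n)" "y (m + n)"] by auto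
      have "a < m"
      proof (rule ccontr)
        assume "\<not> a < m"
        then have "int p ^ m dvd x (m + n)" using ab(2) power_le_dvd[of "int p" a _ m] by simp
        then show False using m padic_int_mod_le[OF x, of m "m + n"] by simp
      qed
      moreover have "b < n"
      proof (rule ccontr)
        assume "\<not> b < n"
        then have "int p ^ n dvd y (m + n)" using ab(3) power_le_dvd[of "int p" b _ n] by simp
        then show False using n padic_int_mod_le[OF y, of n "m + n"] by simp
      qed
      ultimately show False using ab(1) by simp
    qed
  qed
qed

section \<open>Fractions over a domain\<close>

context domain
begin

lemma fraction_eqI:
  assumes "a \<in> carrier R" "b \<in> carrier R - {\<zero>}" "(c, d) \<in> fraction R a b"
  shows "fraction R c d = fraction R a b"
proof -
  have cd: "c \<in> carrier R" "d \<in> carrier R" "d \<noteq> \<zero>" and eq: "a \<otimes> d = c \<otimes> b"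
    using assms(3) by (auto simp: fraction_def)
  have "c \<otimes> v = u \<otimes> d \<longleftrightarrow> a \<otimes> v = u \<otimes> b" if uv: "u \<in> carrier R" "v \<in> carrier R" for u v
  proof -
    have b: "b \<in> carrier R" "b \<noteq> \<zero>" using assms by auto
    have "c \<otimes> v = u \<otimes> d \<longleftrightarrow> b \<otimes> (c \<otimes> v) = b \<otimes> (u \<otimes> d)"
      using b cd uv by (simp add: m_lcancel)
    also have "b \<otimes> (c \<otimes> v) = (c \<otimes> b) \<otimes> v"
      using b cd uv by (simp add: m_ac)
    also have "\<dots> = d \<otimes> (a \<otimes> v)"
      unfolding eq[symmetric] using assms(1) cd uv by (simp add: m_ac)
    also have "b \<otimes> (u \<otimes> d) = d \<otimes> (u \<otimes> b)"
      using b cd uv by (simp add: m_ac)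
    finally show ?thesis using assms(1) b cd uv by (simp add: m_lcancel)
  qed
  then show ?thesis by (auto simp: fraction_def)
qed

lemma fraction_self: "a \<in> carrier R \<Longrightarrow> b \<in> carrier R - {\<zero>} \<Longrightarrow> (a, b) \<in> fraction R a b"
  by (simp add: fraction_def)

text \<open>The union in the definition of a field operation has a constant nonempty family of sets,
  so it collapses to their common value once independence of representatives is known.\<close>

lemma fraction_UN:
  assumes ab: "a \<in> carrier R" "b \<in> carrier R - {\<zero>}" and cd: "c \<in> carrier R" "d \<in> carrier R - {\<zero>}"
    and F: "\<And>a' b' c' d'. (a', b') \<in> fraction R a b \<Longrightarrow> (c', d') \<in> fraction R c d \<Longrightarrow>
      F a' b' c' d' = V"
  shows "(\<Union>(a', b')\<in>fraction R a b. \<Union>(c', d')\<in>fraction R c d. F a' b' c' d') = V"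
  using F fraction_self[OF ab] fraction_self[OF cd] by fastforce

lemma fraction_mult:
  assumes ab: "a \<in> carrier R" "b \<in> carrier R - {\<zero>}" and cd: "c \<in> carrier R" "d \<in> carrier R - {\<zero>}"
  shows "fraction R a b \<otimes>\<^bsub>fraction_field R\<^esub> fraction R c d = fraction R (a \<otimes> c) (b \<otimes> d)"
  unfolding fraction_field_def monoid.simps
proof (rule fraction_UN[OF ab cd])
  fix a' b' c' d' assume *: "(a', b') \<in> fraction R a b" "(c', d') \<in> fraction R c d"
  then have eq: "a \<otimes> b' = a' \<otimes> b" "c \<otimes> d' = c' \<otimes> d"
    and R: "a' \<in> carrier R" "b' \<in> carrier R" "c' \<in> carrier R" "d' \<in> carrier R" "b' \<noteq> \<zero>" "d' \<noteq> \<zero>"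
    by (auto simp: fraction_def)
  have "(a \<otimes> c) \<otimes> (b' \<otimes> d') = (a \<otimes> b') \<otimes> (c \<otimes> d')"
    using R ab cd by (simp add: m_ac)
  also have "\<dots> = (a' \<otimes> c') \<otimes> (b \<otimes> d)"
    unfolding eq using R ab cd by (simp add: m_ac)
  finally show "fraction R (a' \<otimes> c') (b' \<otimes> d') = fraction R (a \<otimes> c) (b \<otimes> d)"
    using R ab cd by (intro fraction_eqI) (auto simp: fraction_def integral_iff)
qed

lemma fraction_add:
  assumes ab: "a \<in> carrier R" "b \<in> carrier R - {\<zero>}" and cd: "c \<in> carrier R" "d \<in> carrier R - {\<zero>}"
  shows "fraction R a b \<oplus>\<^bsub>fraction_field R\<^esub> fraction R c d = fraction R (a \<otimes> d \<oplus> c \<otimes> b) (b \<otimes> d)"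
  unfolding fraction_field_def ring.simps
proof (rule fraction_UN[OF ab cd])
  fix a' b' c' d' assume *: "(a', b') \<in> fraction R a b" "(c', d') \<in> fraction R c d"
  then have eq: "a \<otimes> b' = a' \<otimes> b" "c \<otimes> d' = c' \<otimes> d"
    and R: "a' \<in> carrier R" "b' \<in> carrier R" "c' \<in> carrier R" "d' \<in> carrier R" "b' \<noteq> \<zero>" "d' \<noteq> \<zero>"
    by (auto simp: fraction_def)
  have "(a \<otimes> d \<oplus> c \<otimes> b) \<otimes> (b' \<otimes> d') = (a \<otimes> b') \<otimes> (d \<otimes> d') \<oplus> (c \<otimes> d') \<otimes> (b \<otimes> b')"
    using R ab cd by (simp add: l_distr r_distr m_ac)
  also have "\<dots> = (a' \<otimes> d' \<oplus> c' \<otimes> b') \<otimes> (b \<otimes> d)"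
    unfolding eq using R ab cd by (simp add: l_distr r_distr m_ac)
  finally show "fraction R (a' \<otimes> d' \<oplus> c' \<otimes> b') (b' \<otimes> d') = fraction R (a \<otimes> d \<oplus> c \<otimes> b) (b \<otimes> d)"
    using R ab cd by (intro fraction_eqI) (auto simp: fraction_def integral_iff)
qed

lemma fraction_embedding: "(\<lambda>a. fraction R a \<one>) \<in> ring_hom R (fraction_field R)"
proof (rule ring_hom_memI)
  fix a assume "a \<in> carrier R"
  moreover have "\<one> \<in> carrier R - {\<zero>}" by simp
  ultimately show "fraction R a \<one> \<in> carrier (fraction_field R)"
    unfolding fraction_field_def partial_object.simps by blast
next
  fix a b assume "a \<in> carrier R" "b \<in> carrier R"
  then show "fraction R (a \<otimes> b) \<one> = fraction R a \<one> \<otimes>\<^bsub>fraction_field R\<^esub> fraction R b \<one>"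
    "fraction R (a \<oplus> b) \<one> = fraction R a \<one> \<oplus>\<^bsub>fraction_field R\<^esub> fraction R b \<one>"
    by (simp_all add: fraction_mult fraction_add)
qed (simp add: fraction_field_def)

end

text \<open>The composite of \<open>\<int>\<^sub>p\<close> \<rightarrow>
  \<open>\<rat>\<^sub>p\<close> \<rightarrow> L is a ring homomorphism. Its image being a subring is
  what makes the simple extension by \<theta> a subring of L.\<close>

lemma padic_integers_image_subring:
  assumes p: "Factorial_Ring.prime p" and L: "ring L" and \<iota>: "\<iota> \<in> ring_hom (padic_field p) L"
  shows "subring (\<iota> ` padic_integers p) L"
proof -
  let ?Z = "padic_int p"
  interpret Z: domain ?Z by (rule padic_int_domain[OF p])
  have "\<iota> \<circ> (\<lambda>a. fraction ?Z a \<one>\<^bsub>?Z\<^esub>) \<in> ring_hom ?Z L"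
    using ring_hom_trans[OF Z.fraction_embedding] \<iota> by (simp add: padic_field_def)
  then interpret ring_hom_ring ?Z L "\<iota> \<circ> (\<lambda>a. fraction ?Z a \<one>\<^bsub>?Z\<^esub>)"
    using L Z.ring_axioms by (intro ring_hom_ringI2)
  show ?thesis
    using img_is_subring[OF ring.carrier_is_subring[OF Z.ring_axioms]]
    by (simp add: padic_integers_def image_comp)
qed

section \<open>Arithmetic in a domain with a \<open>p\<close>-th root of unity\<close>

lemma (in cring) binomial_finsum:
  assumes x: "x \<in> carrier R"
  shows "(\<one> \<oplus> x) [^] (n::nat) = (\<Oplus>i\<in>{..n}. (add_pow R (n choose i) (x [^] i)))"
proof (induction n)
  case 0
  show ?case by simp
next
  case (Suc n)
  let ?f = "\<lambda>m i. (add_pow R (m choose i) (x [^] (i::nat)))"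
  have f: "?f m \<in> A \<rightarrow> carrier R" for m A using x by auto
  have "(\<one> \<oplus> x) [^] Suc n = (\<Oplus>i\<in>{..n}. ?f n i) \<oplus> (\<Oplus>i\<in>{..n}. ?f n i) \<otimes> x"
    using x f[of n "{..n}"] by (simp add: Suc r_distr)
  also have "(\<Oplus>i\<in>{..n}. ?f n i) \<otimes> x = (\<Oplus>i\<in>{..n}. (add_pow R (n choose i) (x [^] Suc i)))"
    using x f by (subst finsum_ldistr) (auto intro!: finsum_cong' simp: add_pow_ldistr)
  \<comment> \<open>The added term has coefficient n choose n + 1 = 0. With it, splitting off the
    constant term leaves a sum over the same range as the other one, and Pascal's rule applies
    termwise.\<close>
  also have "(\<Oplus>i\<in>{..n}. ?f n i) = (\<Oplus>i\<in>{..Suc n}. ?f n i)"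
    using f[of n] x by (subst finsum_Suc) (auto simp: binomial_eq_0)
  also have "\<dots> = (\<Oplus>i\<in>{..n}. ?f n (Suc i)) \<oplus> \<one>"
    using f[of n] x by (subst finsum_Suc2) (auto simp del: nat_pow_Suc)
  finally have "(\<one> \<oplus> x) [^] Suc n =
      (\<Oplus>i\<in>{..n}. (add_pow R (n choose i) (x [^] Suc i))) \<oplus> (\<Oplus>i\<in>{..n}. (add_pow R (n choose Suc i) (x [^] Suc i))) \<oplus> \<one>"
    using x by (simp add: a_ac del: nat_pow_Suc)
  also have "(\<Oplus>i\<in>{..n}. (add_pow R (n choose i) (x [^] Suc i))) \<oplus> (\<Oplus>i\<in>{..n}. (add_pow R (n choose Suc i) (x [^] Suc i))) =
      (\<Oplus>i\<in>{..n}. ?f (Suc n) (Suc i))"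
    using x by (subst finsum_addf[symmetric])
      (auto intro!: finsum_cong' simp: add.nat_pow_mult simp del: nat_pow_Suc)
  also have "\<dots> \<oplus> \<one> = (\<Oplus>i\<in>{..Suc n}. ?f (Suc n) i)"
    using f[of "Suc n"] x by (subst finsum_Suc2) (auto simp del: nat_pow_Suc)
  finally show ?case .
qed

text \<open>The abstract form of \<O>. As p is prime, \<theta> \<noteq> 1 already makes \<theta> a
  primitive p-th root of unity.\<close>

locale cyclotomic_domain = domain R for R (structure) +
  fixes p :: nat and \<theta> :: 'a
  assumes prime: "Factorial_Ring.prime p"
    and \<theta>_closed [simp]: "\<theta> \<in> carrier R"
    and \<theta>_pow: "\<theta> [^] p = \<one>" and \<theta>_neq: "\<theta> \<noteq> \<one>"
begin

definition \<pi> where "\<pi> = \<theta> \<ominus> \<one>"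

lemma \<pi>_closed [simp]: "\<pi> \<in> carrier R" by (simp add: \<pi>_def)

lemma \<theta>_eq: "\<theta> = \<one> \<oplus> \<pi>"
  unfolding \<pi>_def using \<theta>_closed one_closed by algebra

lemma \<pi>_nonzero [simp]: "\<pi> \<noteq> \<zero>"
  using \<theta>_eq \<theta>_neq by auto

lemma p_gt_1: "p > 1" using prime prime_gt_1_nat by blast

definition PI :: "nat \<Rightarrow> 'a set"
  where "PI m = (\<lambda>r. \<pi> [^] m \<otimes> r) ` carrier R"

lemma PI_I [intro]: "r \<in> carrier R \<Longrightarrow> \<pi> [^] m \<otimes> r \<in> PI m"
  by (auto simp: PI_def)

lemma PI_closed: "x \<in> PI m \<Longrightarrow> x \<in> carrier R"
  by (auto simp: PI_def)

lemma PI_zero [simp]: "\<zero> \<in> PI m"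
  using PI_I[of \<zero> m] by simp

lemma PI_add: "x \<in> PI m \<Longrightarrow> y \<in> PI m \<Longrightarrow> x \<oplus> y \<in> PI m"
  by (auto simp: PI_def r_distr[symmetric])

lemma PI_inv: "x \<in> PI m \<Longrightarrow> \<ominus> x \<in> PI m"
  by (auto simp: PI_def r_minus[symmetric])

lemma PI_minus: "x \<in> PI m \<Longrightarrow> y \<in> PI m \<Longrightarrow> x \<ominus> y \<in> PI m"
  by (simp add: a_minus_def PI_add PI_inv)

lemma PI_mult: "x \<in> PI m \<Longrightarrow> y \<in> carrier R \<Longrightarrow> x \<otimes> y \<in> PI m"
  by (auto simp: PI_def m_assoc)

lemma PI_mult': "x \<in> PI m \<Longrightarrow> y \<in> carrier R \<Longrightarrow> y \<otimes> x \<in> PI m"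
  using PI_mult[of x m y] by (simp add: m_comm PI_closed)

lemma \<pi>_pow_nonzero [simp]: "\<pi> [^] (m::nat) \<noteq> \<zero>"
  by (induction m) (auto simp: integral_iff)

lemma \<pi>_pow_cancel:
  "x \<in> carrier R \<Longrightarrow> y \<in> carrier R \<Longrightarrow> \<pi> [^] (m::nat) \<otimes> x = \<pi> [^] m \<otimes> y \<longleftrightarrow> x = y"
  by (simp add: m_lcancel)

text \<open>This cancellation is how i disappears: congruences modulo \<pi>^(c+p-1) between
  multiples of \<pi>^c become congruences modulo \<pi>^(p-1).\<close>

lemma PI_shift: "x \<in> carrier R \<Longrightarrow> \<pi> [^] c \<otimes> x \<in> PI (c + m) \<longleftrightarrow> x \<in> PI m"
  by (auto simp: PI_def m_assoc \<pi>_pow_cancel simp flip: nat_pow_mult)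

lemma PI_antimono: "m \<le> n \<Longrightarrow> x \<in> PI n \<Longrightarrow> x \<in> PI m"
proof -
  assume "m \<le> n" "x \<in> PI n"
  then obtain r where "r \<in> carrier R" "x = \<pi> [^] (m + (n - m)) \<otimes> r"
    by (auto simp: PI_def)
  then show "x \<in> PI m"
    using PI_I[of "\<pi> [^] (n - m) \<otimes> r" m] by (simp add: m_assoc flip: nat_pow_mult)
qed

lemma PI_0 [simp]: "PI 0 = carrier R"
  by (auto simp: PI_def)

text \<open>Divide \<open>(1 + \<pi>)\<^sup>p = 1\<close> by \<open>\<pi>\<close> and use that \<open>p\<close> divides the inner binomial coefficients.\<close>

lemma p_relation: "\<exists>w\<in>carrier R. (add_pow R p \<one>) \<otimes> (\<one> \<oplus> \<pi> \<otimes> w) = \<ominus> (\<pi> [^] (p - 1))"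
proof -
  let ?P = "add_pow R p \<one>"
  let ?f = "\<lambda>i::nat. (add_pow R (p choose i) (\<pi> [^] i))"
  let ?g = "\<lambda>i. (add_pow R ((p choose i) div p) (\<pi> [^] (i - 2)))"
  have f: "?f \<in> A \<rightarrow> carrier R" for A by auto
  have p_split: "{..p} = insert 0 (insert 1 (insert p {2..<p}))"
    using p_gt_1 by auto
  \<comment> \<open>The terms with 2 \<le> i < p are divisible by p and by \<pi>^2; \<open>w\<close>
    collects what is left of them. The other terms are 1, p\<pi> and \<pi>^p.\<close>
  define w where "w = (\<Oplus>i\<in>{2..<p}. ?g i)"
  have w: "w \<in> carrier R" unfolding w_def by (intro finsum_closed) auto
  have P: "(add_pow R m x) = (add_pow R m \<one>) \<otimes> x" if "x \<in> carrier R" for x and m :: nat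
    using that by (simp add: add_pow_ldistr)
  have "?f i = (?P \<otimes> \<pi> [^] (2::nat)) \<otimes> ?g i" if "i \<in> {2..<p}" for i
  proof -
    have "p choose i = p * ((p choose i) div p)"
      using dvd_choose_prime[of i p] prime that by simp
    then have "?f i = (add_pow R p ((add_pow R ((p choose i) div p) (\<pi> [^] i))))"
      by (metis \<pi>_closed add.nat_pow_pow mult.commute nat_pow_closed)
    also have "\<dots> = ?P \<otimes> (add_pow R ((p choose i) div p) (\<pi> [^] i))"
      by (rule P) simp
    also have "add_pow R ((p choose i) div p) (\<pi> [^] i) = \<pi> [^] (2::nat) \<otimes> ?g i"
      using that nat_pow_mult[of \<pi> 2 "i - 2"] add_pow_rdistr[of "\<pi> [^] (2::nat)" "\<pi> [^] (i - 2)"]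
      by (metis \<pi>_closed atLeastLessThan_iff le_add_diff_inverse nat_pow_closed)
    finally show ?thesis by (simp add: m_assoc)
  qed
  then have mid: "(\<Oplus>i\<in>{2..<p}. ?f i) = (?P \<otimes> \<pi> [^] (2::nat)) \<otimes> w"
    unfolding w_def by (subst finsum_rdistr) (auto intro!: finsum_cong')
  have "\<one> = (\<Oplus>i\<in>{..p}. ?f i)"
    using binomial_finsum[of \<pi> p] \<theta>_pow \<theta>_eq by simp
  also have "\<dots> = \<one> \<oplus> (?P \<otimes> \<pi> \<oplus> (\<pi> [^] p \<oplus> (?P \<otimes> \<pi> [^] (2::nat)) \<otimes> w))"
    unfolding p_split using p_gt_1 P[of \<pi> p] by (simp add: mid[symmetric])
  finally have "?P \<otimes> \<pi> \<oplus> (\<pi> [^] p \<oplus> (?P \<otimes> \<pi> [^] (2::nat)) \<otimes> w) = \<zero>"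
    using w by (metis (no_types, lifting) a_closed add.l_cancel_one' m_closed nat_pow_closed
        one_closed add.nat_pow_closed \<pi>_closed)
  moreover have "\<pi> [^] p = \<pi> [^] (p - 1) \<otimes> \<pi>"
    using p_gt_1 nat_pow_Suc[of \<pi> "p - 1"] by simp
  ultimately have "\<pi> \<otimes> (?P \<otimes> (\<one> \<oplus> \<pi> \<otimes> w) \<oplus> \<pi> [^] (p - 1)) = \<zero>"
    using w by (simp add: r_distr l_distr m_ac a_ac numeral_2_eq_2)
  then have "?P \<otimes> (\<one> \<oplus> \<pi> \<otimes> w) \<oplus> \<pi> [^] (p - 1) = \<zero>"
    using w by (simp add: integral_iff)
  then have "?P \<otimes> (\<one> \<oplus> \<pi> \<otimes> w) = \<ominus> (\<pi> [^] (p - 1))"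
    using w by (intro minus_equality[symmetric]) (simp_all add: a_comm)
  with w show ?thesis by blast
qed

text \<open>Instead of inverting 1 + \<pi>w, read the relation as p = -\<pi>^(p-1) - p\<pi>w. If p
  lies in (\<pi>^k) with k < p - 1, both terms on the right lie in (\<pi>^(k+1)), so the exponent
  climbs to p - 1.\<close>

lemma p_in_PI: "(add_pow R p \<one>) \<in> PI (p - 1)"
proof -
  let ?P = "add_pow R p \<one>"
  obtain w where w: "w \<in> carrier R" and rel: "?P \<otimes> (\<one> \<oplus> \<pi> \<otimes> w) = \<ominus> (\<pi> [^] (p - 1))"
    using p_relation by blast
  have top: "\<ominus> (\<pi> [^] (p - 1)) \<in> PI (p - 1)"
    using PI_inv[OF PI_I[of \<one> "p - 1"]] by simp
  have "k \<le> p - 1 \<Longrightarrow> ?P \<in> PI k" for k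
  proof (induction k)
    case (Suc k)
    then obtain r where r: "r \<in> carrier R" "?P = \<pi> [^] k \<otimes> r"
      by (auto simp: PI_def)
    have "?P = \<ominus> (\<pi> [^] (p - 1)) \<ominus> ?P \<otimes> (\<pi> \<otimes> w)"
      unfolding rel[symmetric] using w by (simp add: r_distr a_minus_def a_assoc r_neg)
    moreover have "?P \<otimes> (\<pi> \<otimes> w) = \<pi> [^] Suc k \<otimes> (r \<otimes> w)"
      unfolding r(2) using r w by (simp add: m_ac)
    ultimately show ?case
      using PI_minus[OF PI_antimono[OF Suc.prems top] PI_I[of "r \<otimes> w" "Suc k"]] r w by simp
  qed auto
  then show ?thesis by simp
qed

lemma p_mult_PI: "x \<in> carrier R \<Longrightarrow> (add_pow R p x) \<in> PI (p - 1)"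
  using PI_mult[OF p_in_PI, of x] by (simp add: add_pow_ldistr)

text \<open>Multiplying px by 1 + \<pi>w gives -\<pi>^(p-1) x, from which \<pi>^(p-1) can be
  cancelled. With \<open>p_in_PI\<close> this says that p behaves like \<pi>^(p-1).\<close>

lemma p_torsion:
  assumes x: "x \<in> carrier R" and "(add_pow R p x) \<in> PI (c + (p - 1))"
  shows "x \<in> PI c"
proof -
  let ?P = "add_pow R p \<one>"
  obtain w where w: "w \<in> carrier R" and rel: "?P \<otimes> (\<one> \<oplus> \<pi> \<otimes> w) = \<ominus> (\<pi> [^] (p - 1))"
    using p_relation by blast
  have "(add_pow R p x) \<otimes> (\<one> \<oplus> \<pi> \<otimes> w) = (?P \<otimes> (\<one> \<oplus> \<pi> \<otimes> w)) \<otimes> x"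
    using w x by (simp add: add_pow_ldistr add_pow_rdistr m_ac)
  also have "\<dots> = \<ominus> (\<pi> [^] (p - 1) \<otimes> x)"
    using x by (simp add: rel l_minus)
  finally have "\<ominus> (\<pi> [^] (p - 1) \<otimes> x) \<in> PI (c + (p - 1))"
    using PI_mult[OF assms(2), of "\<one> \<oplus> \<pi> \<otimes> w"] w by simp
  from PI_inv[OF this] show ?thesis
    using x PI_shift[of x "p - 1" c] by (simp add: add.commute)
qed

end

section \<open>The group and its lower central series\<close>

context cyclotomic_domain
begin

definition \<theta>p :: "int \<Rightarrow> 'a" where "\<theta>p k = \<theta> [^] nat k"

lemma \<theta>p_closed [simp]: "\<theta>p k \<in> carrier R" and \<theta>p_0 [simp]: "\<theta>p 0 = \<one>"
  by (simp_all add: \<theta>p_def)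

text \<open>The \<theta>-analogue 1 + \<theta> + ... + \<theta>^(n-1) of the integer n. Written as a
  sum, it needs no division by \<pi>.\<close>

primrec bracket_nat :: "nat \<Rightarrow> 'a" where
  "bracket_nat 0 = \<zero>"
| "bracket_nat (Suc n) = bracket_nat n \<oplus> \<theta> [^] n"

definition bracket :: "int \<Rightarrow> 'a" where "bracket k = bracket_nat (nat k)"

lemma bracket_nat_closed [simp]: "bracket_nat n \<in> carrier R"
  by (induction n) auto

lemma bracket_closed [simp]: "bracket k \<in> carrier R"
  by (simp add: bracket_def)

lemma bracket_0 [simp]: "bracket 0 = \<zero>" and bracket_1 [simp]: "bracket 1 = \<one>"
  by (simp_all add: bracket_def)

lemma \<pi>_bracket_nat: "\<pi> \<otimes> bracket_nat n = \<theta> [^] n \<ominus> \<one>"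
proof (induction n)
  case (Suc n)
  have *: "\<theta> [^] n \<in> carrier R" by simp
  show ?case
  proof -
    have "(\<theta> [^] n \<ominus> \<one>) \<oplus> \<pi> \<otimes> \<theta> [^] n = \<theta> [^] n \<otimes> \<theta> \<ominus> \<one>"
      using * one_closed \<theta>_closed unfolding \<pi>_def by algebra
    then show ?thesis by (simp add: Suc r_distr)
  qed
qed (simp add: a_minus_def r_neg)

lemma \<pi>_bracket: "\<pi> \<otimes> bracket k = \<theta>p k \<ominus> \<one>"
  unfolding bracket_def \<theta>p_def by (rule \<pi>_bracket_nat)

lemma \<theta>p_eq: "\<theta>p k = \<one> \<oplus> \<pi> \<otimes> bracket k"
proof -
  have "\<theta>p k \<in> carrier R" by simp
  then show ?thesis unfolding \<pi>_bracket using one_closed by algebra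
qed

lemma \<theta>_pow_mod: "\<theta> [^] (n mod p) = \<theta> [^] n"
proof -
  have "\<theta> [^] n = \<theta> [^] (n mod p + p * (n div p))"
    by simp
  also have "\<dots> = \<theta> [^] (n mod p) \<otimes> (\<theta> [^] p) [^] (n div p)"
    by (simp only: nat_pow_mult[symmetric] nat_pow_pow \<theta>_closed)
  finally show ?thesis by (simp add: \<theta>_pow)
qed

lemma \<theta>p_add: "0 \<le> k \<Longrightarrow> 0 \<le> l \<Longrightarrow> \<theta>p ((k + l) mod int p) = \<theta>p k \<otimes> \<theta>p l"
  unfolding \<theta>p_def
  using p_gt_1 by (simp only: nat_mod_distrib \<theta>_pow_mod nat_pow_mult nat_add_distrib \<theta>_closed
      nat_int add_nonneg_nonneg of_nat_0_le_iff)

text \<open>The cocycle identity of the crossed homomorphism k \<mapsto> [k]. After multiplication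
  by \<pi> it concerns the coboundary \<theta>^k - 1, where reduction of the exponent modulo p is
  harmless, and \<pi> can be cancelled.\<close>

lemma bracket_add:
  assumes "0 \<le> k" "0 \<le> l"
  shows "bracket ((k + l) mod int p) = bracket k \<oplus> \<theta>p k \<otimes> bracket l"
proof -
  have *: "\<theta>p k \<in> carrier R" "\<theta>p l \<in> carrier R" by simp_all
  have "\<pi> \<otimes> bracket ((k + l) mod int p) = \<theta>p k \<otimes> \<theta>p l \<ominus> \<one>"
    using assms by (simp only: \<pi>_bracket \<theta>p_add)
  also have "\<dots> = (\<theta>p k \<ominus> \<one>) \<oplus> \<theta>p k \<otimes> (\<theta>p l \<ominus> \<one>)"
    using * one_closed by algebra
  also have "\<dots> = \<pi> \<otimes> (bracket k \<oplus> \<theta>p k \<otimes> bracket l)"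
    by (simp only: \<pi>_bracket[symmetric]) (simp add: r_distr m_lcomm)
  finally show ?thesis
    by (simp add: m_lcancel)
qed

definition Cyc :: "int set" where "Cyc = {0..<int p}"

lemma Cyc_0 [simp]: "0 \<in> Cyc" and Cyc_1 [simp]: "1 \<in> Cyc"
  and Cyc_mod [simp]: "k mod int p \<in> Cyc" and Cyc_nonneg: "k \<in> Cyc \<Longrightarrow> 0 \<le> k"
  and Cyc_mod_self: "k \<in> Cyc \<Longrightarrow> k mod int p = k"
  using p_gt_1 by (auto simp: Cyc_def)

definition G :: "('a \<times> int) monoid"
  where "G = semidirect_product (add_monoid R) (integer_mod_group p) (\<lambda>k x. \<theta> [^] nat k \<otimes> x)"

lemma G_carrier: "carrier G = carrier R \<times> Cyc"
  using p_gt_1 by (simp add: G_def semidirect_product_def Cyc_def carrier_integer_mod_group)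

lemma G_carrier_iff [simp]: "(x, k) \<in> carrier G \<longleftrightarrow> x \<in> carrier R \<and> k \<in> Cyc"
  by (simp add: G_carrier)

lemma G_mult [simp]: "(x, k) \<otimes>\<^bsub>G\<^esub> (y, l) = (x \<oplus> \<theta>p k \<otimes> y, (k + l) mod int p)"
  by (simp add: G_def semidirect_product_def \<theta>p_def)

lemma G_one [simp]: "\<one>\<^bsub>G\<^esub> = (\<zero>, 0)"
  by (simp add: G_def semidirect_product_def)

lemma group_G: "group G"
proof (rule groupI)
  fix g h assume "g \<in> carrier G" "h \<in> carrier G"
  then show "g \<otimes>\<^bsub>G\<^esub> h \<in> carrier G"
    by (auto simp: G_carrier)
next
  fix f g h assume "f \<in> carrier G" "g \<in> carrier G" "h \<in> carrier G"
  then obtain x k y l z m where *: "f = (x, k)" "g = (y, l)" "h = (z, m)"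
    "x \<in> carrier R" "y \<in> carrier R" "z \<in> carrier R" "k \<in> Cyc" "l \<in> Cyc" "m \<in> Cyc"
    by (auto simp: G_carrier)
  then show "f \<otimes>\<^bsub>G\<^esub> g \<otimes>\<^bsub>G\<^esub> h = f \<otimes>\<^bsub>G\<^esub> (g \<otimes>\<^bsub>G\<^esub> h)"
    using \<theta>p_add[of k l] by (simp add: Cyc_nonneg r_distr a_assoc m_assoc mod_simps add.assoc)
next
  fix g assume "g \<in> carrier G"
  then obtain x k where *: "g = (x, k)" "x \<in> carrier R" "k \<in> Cyc"
    by (auto simp: G_carrier)
  let ?k = "(- k) mod int p"
  have "(\<ominus> (\<theta>p ?k \<otimes> x), ?k) \<otimes>\<^bsub>G\<^esub> g = \<one>\<^bsub>G\<^esub>"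
    using * by (simp add: l_neg mod_simps)
  then show "\<exists>h\<in>carrier G. h \<otimes>\<^bsub>G\<^esub> g = \<one>\<^bsub>G\<^esub>"
    using * by (intro bexI[of _ "(\<ominus> (\<theta>p ?k \<otimes> x), ?k)"]) auto
qed (auto simp: G_carrier Cyc_mod_self)

sublocale G: group G by (rule group_G)

text \<open>Multiplying by \<open>(y, j)\<close> on the right avoids computing an inverse; then
  \<pi>y[k] = (\<theta>^k - 1)y accounts for the difference between y and \<theta>^k y.\<close>

lemma G_conj:
  assumes "y \<in> carrier R" "j \<in> Cyc" "a \<in> carrier R" "k \<in> Cyc"
  shows "(y, j) \<otimes>\<^bsub>G\<^esub> (a, k) \<otimes>\<^bsub>G\<^esub> inv\<^bsub>G\<^esub> (y, j) = (\<theta>p j \<otimes> a \<ominus> \<pi> \<otimes> y \<otimes> bracket k, k)"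
proof -
  have *: "\<theta>p j \<in> carrier R" "\<theta>p k \<in> carrier R" by simp_all
  have "\<pi> \<otimes> y \<otimes> bracket k = (\<theta>p k \<ominus> \<one>) \<otimes> y"
    using assms by (simp add: \<pi>_bracket[symmetric] m_ac)
  then have "\<theta>p j \<otimes> a \<ominus> \<pi> \<otimes> y \<otimes> bracket k \<oplus> \<theta>p k \<otimes> y = \<theta>p j \<otimes> a \<ominus> (\<theta>p k \<ominus> \<one>) \<otimes> y \<oplus> \<theta>p k \<otimes> y"
    by simp
  also have "\<dots> = y \<oplus> \<theta>p j \<otimes> a"
    using * assms one_closed by algebra
  finally have "(y, j) \<otimes>\<^bsub>G\<^esub> (a, k) = (\<theta>p j \<otimes> a \<ominus> \<pi> \<otimes> y \<otimes> bracket k, k) \<otimes>\<^bsub>G\<^esub> (y, j)"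
    by (simp add: add.commute)
  with assms show ?thesis
    by (simp add: G.inv_solve_right' del: G_mult)
qed

text \<open>Substituting 1 + \<pi>[j] for \<theta>^j exposes a factor \<pi> in every commutator.
  This is why each step of the lower central series raises the exponent of \<pi> by one.\<close>

lemma G_commutator:
  assumes "y \<in> carrier R" "j \<in> Cyc" "a \<in> carrier R" "k \<in> Cyc"
  shows "(y, j) \<otimes>\<^bsub>G\<^esub> (a, k) \<otimes>\<^bsub>G\<^esub> inv\<^bsub>G\<^esub> (y, j) \<otimes>\<^bsub>G\<^esub> inv\<^bsub>G\<^esub> (a, k) =
    (\<pi> \<otimes> (bracket j \<otimes> a \<ominus> y \<otimes> bracket k), 0)"
proof -
  have "\<theta>p j \<otimes> a \<ominus> \<pi> \<otimes> y \<otimes> bracket k = \<pi> \<otimes> (bracket j \<otimes> a \<ominus> y \<otimes> bracket k) \<oplus> a"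
    using assms unfolding \<theta>p_eq by (simp add: a_minus_def l_distr r_distr r_minus m_assoc a_ac)
  then have "(\<theta>p j \<otimes> a \<ominus> \<pi> \<otimes> y \<otimes> bracket k, k) = (\<pi> \<otimes> (bracket j \<otimes> a \<ominus> y \<otimes> bracket k), 0) \<otimes>\<^bsub>G\<^esub> (a, k)"
    using assms by (simp add: Cyc_mod_self)
  then show ?thesis
    unfolding G_conj[OF assms] using assms by (simp add: G.inv_solve_right' del: G_mult)
qed

lemma G_inv_0: "x \<in> carrier R \<Longrightarrow> inv\<^bsub>G\<^esub> (x, 0) = (\<ominus> x, 0)"
  by (rule G.inv_equality) (auto simp: l_neg)

lemma PI_subgroup: "subgroup (PI m \<times> {0::int}) G"
  by (rule G.subgroupI) (auto simp: PI_closed G_inv_0 PI_inv PI_add)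

lemma PI_normal: "(PI m \<times> {0::int}) \<lhd> G"
proof (rule G.normal_invI[OF PI_subgroup])
  fix g h assume "g \<in> carrier G" "h \<in> PI m \<times> {0::int}"
  then show "g \<otimes>\<^bsub>G\<^esub> h \<otimes>\<^bsub>G\<^esub> inv\<^bsub>G\<^esub> g \<in> PI m \<times> {0::int}"
    by (auto simp: G_carrier G_conj PI_closed PI_mult' a_minus_def simp del: G_mult)
qed

text \<open>Stated for any \<open>A\<close> containing \<pi>^m R, so that it covers both the first
  step, where \<open>A\<close> is all of G, and the later ones, where \<open>A\<close> is the
  previous term.\<close>

lemma lower_central_step:
  assumes A: "PI m \<times> {0::int} \<subseteq> A"
    and sub: "(\<Union>a\<in>A. \<Union>b\<in>carrier G. {a \<otimes>\<^bsub>G\<^esub> b \<otimes>\<^bsub>G\<^esub> inv\<^bsub>G\<^esub> a \<otimes>\<^bsub>G\<^esub> inv\<^bsub>G\<^esub> b}) \<subseteq> PI (Suc m) \<times> {0::int}"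
  shows "commutator_subgroup G A (carrier G) = PI (Suc m) \<times> {0::int}"
  unfolding commutator_subgroup_def
proof (rule equalityI)
  show "generate G (\<Union>a\<in>A. \<Union>b\<in>carrier G. {a \<otimes>\<^bsub>G\<^esub> b \<otimes>\<^bsub>G\<^esub> inv\<^bsub>G\<^esub> a \<otimes>\<^bsub>G\<^esub> inv\<^bsub>G\<^esub> b}) \<subseteq> PI (Suc m) \<times> {0::int}"
    using G.generate_subgroup_incl[OF sub PI_subgroup] .
next
  show "PI (Suc m) \<times> {0::int} \<subseteq> generate G (\<Union>a\<in>A. \<Union>b\<in>carrier G. {a \<otimes>\<^bsub>G\<^esub> b \<otimes>\<^bsub>G\<^esub> inv\<^bsub>G\<^esub> a \<otimes>\<^bsub>G\<^esub> inv\<^bsub>G\<^esub> b})"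
  proof
    fix g assume "g \<in> PI (Suc m) \<times> {0::int}"
    then obtain r where r: "r \<in> carrier R" "g = (\<pi> [^] Suc m \<otimes> r, 0)"
      by (auto simp: PI_def)
    \<comment> \<open>With j = 0 and k = 1 the commutator formula reduces to -\<pi>y, so every
      element of \<pi>^(m+1) R is a single commutator with the generator of the cyclic
      factor.\<close>
    let ?a = "(\<ominus> (\<pi> [^] m \<otimes> r), 0)" and ?b = "(\<zero>, 1)"
    have "?a \<otimes>\<^bsub>G\<^esub> ?b \<otimes>\<^bsub>G\<^esub> inv\<^bsub>G\<^esub> ?a \<otimes>\<^bsub>G\<^esub> inv\<^bsub>G\<^esub> ?b = g"
      using r by (subst G_commutator) (auto simp: a_minus_def m_ac)
    moreover have "?a \<in> A" using A r PI_inv[OF PI_I] by auto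
    moreover have "?b \<in> carrier G" by simp
    ultimately show "g \<in> generate G (\<Union>a\<in>A. \<Union>b\<in>carrier G.
        {a \<otimes>\<^bsub>G\<^esub> b \<otimes>\<^bsub>G\<^esub> inv\<^bsub>G\<^esub> a \<otimes>\<^bsub>G\<^esub> inv\<^bsub>G\<^esub> b})"
      by (intro generate.incl) (metis (no_types, lifting) UN_I singletonI)
  qed
qed

lemma lower_central_eq: "lower_central G (Suc (Suc m)) = PI (Suc m) \<times> {0::int}"
proof (induction m)
  case 0
  have "commutator_subgroup G (carrier G) (carrier G) = PI (Suc 0) \<times> {0::int}"
  proof (rule lower_central_step)
    show "(\<Union>a\<in>carrier G. \<Union>b\<in>carrier G. {a \<otimes>\<^bsub>G\<^esub> b \<otimes>\<^bsub>G\<^esub> inv\<^bsub>G\<^esub> a \<otimes>\<^bsub>G\<^esub> inv\<^bsub>G\<^esub> b})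
        \<subseteq> PI (Suc 0) \<times> {0::int}"
      by (auto simp: G_carrier G_commutator PI_def simp del: G_mult)
  qed (auto simp: G_carrier)
  then show ?case by simp
next
  case (Suc m)
  have "commutator_subgroup G (PI (Suc m) \<times> {0::int}) (carrier G) = PI (Suc (Suc m)) \<times> {0::int}"
  proof (rule lower_central_step)
    have "(a \<otimes>\<^bsub>G\<^esub> b \<otimes>\<^bsub>G\<^esub> inv\<^bsub>G\<^esub> a \<otimes>\<^bsub>G\<^esub> inv\<^bsub>G\<^esub> b) \<in> PI (Suc (Suc m)) \<times> {0::int}"
      if a: "a \<in> PI (Suc m) \<times> {0::int}" and b: "b \<in> carrier G" for a b
    proof -
      obtain r y k where r: "r \<in> carrier R" "a = (\<pi> [^] Suc m \<otimes> r, 0)"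
        and b: "y \<in> carrier R" "k \<in> Cyc" "b = (y, k)"
        using a b by (auto simp: PI_def G_carrier)
      have "a \<otimes>\<^bsub>G\<^esub> b \<otimes>\<^bsub>G\<^esub> inv\<^bsub>G\<^esub> a \<otimes>\<^bsub>G\<^esub> inv\<^bsub>G\<^esub> b = (\<pi> [^] Suc (Suc m) \<otimes> (\<ominus> (r \<otimes> bracket k)), 0)"
        unfolding r(2) b(3) using r(1) b(1,2) by (subst G_commutator) (auto simp: a_minus_def m_ac r_minus)
      then show ?thesis using r b PI_I[of "\<ominus> (r \<otimes> bracket k)" "Suc (Suc m)"] by simp
    qed
    then show "(\<Union>a\<in>PI (Suc m) \<times> {0::int}. \<Union>b\<in>carrier G. {a \<otimes>\<^bsub>G\<^esub> b \<otimes>\<^bsub>G\<^esub> inv\<^bsub>G\<^esub> a \<otimes>\<^bsub>G\<^esub> inv\<^bsub>G\<^esub> b})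
        \<subseteq> PI (Suc (Suc m)) \<times> {0::int}"
      by blast
  qed auto
  with Suc show ?case by simp
qed

end

section \<open>Elementary abelian subgroups of the quotients\<close>

context cyclotomic_domain
begin

text \<open>
  With \<open>\<pi> = \<theta> - 1\<close> and \<open>[k] = (\<theta>\<^sup>k - 1) / \<pi>\<close>, the triple \<open>(x, S, K)\<close> stands for the subgroup of
  \<open>G / (\<pi>\<^sup>c\<^sup>+\<^sup>p\<^sup>-\<^sup>1)\<close> consisting of the classes of \<open>(x[k] + \<pi>\<^sup>c s, k)\<close> with \<open>s \<in> S\<close> and \<open>k \<in> K\<close>.  The
  inclusion \<open>S \<subseteq> (\<pi>\<^sup>p\<^sup>-\<^sup>2)\<close> expresses that the elements with \<open>k = 0\<close> commute with the one with \<open>k = 1\<close>.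
\<close>

definition subgroup_data :: "('a \<times> 'a set \<times> int set) set"
  where "subgroup_data = {(x, S, K). x \<in> carrier R \<and> subgroup S (add_monoid R) \<and> PI (p - 1) \<subseteq> S \<and>
    (K = {0} \<or> K = Cyc \<and> S \<subseteq> PI (p - 2))}"

definition coords :: "'a \<times> 'a set \<times> int set \<Rightarrow> ('a \<times> int) set"
  where "coords = (\<lambda>(x, S, K). S \<times> K)"

text \<open>
  Conjugation by \<open>(y, j)\<close> replaces \<open>x\<close> by \<open>\<theta>\<^sup>j x - \<pi> y\<close> and \<open>s\<close> by \<open>\<theta>\<^sup>j s\<close>; in the coordinates of a target
  containing the image it is the affine map below, with \<open>\<theta>\<^sup>j x - \<pi> y = x' + \<pi>\<^sup>c \<sigma>\<close>.
\<close>

definition coord_maps :: "'a \<times> 'a set \<times> int set \<Rightarrow> 'a \<times> 'a set \<times> int set \<Rightarrow> ('a \<times> int \<Rightarrow> 'a \<times> int) set"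
  where "coord_maps = (\<lambda>(x, S, K) (x', S', K'). {m. K \<subseteq> K' \<and> (K = {0} \<or> x \<ominus> x' \<in> PI 1) \<and>
    (\<exists>j\<in>Cyc. \<exists>\<sigma>\<in>carrier R. \<forall>s\<in>S. \<forall>k\<in>K.
      \<sigma> \<otimes> bracket k \<oplus> \<theta>p j \<otimes> s \<in> S' \<and> m (s, k) = (\<sigma> \<otimes> bracket k \<oplus> \<theta>p j \<otimes> s, k))})"

lemma coord_maps_coords: "m \<in> coord_maps s t \<Longrightarrow> a \<in> coords s \<Longrightarrow> m a \<in> coords t"
  by (cases s; cases t) (auto simp: coord_maps_def coords_def)

lemma subgroup_data_D:
  assumes "(x, S, K) \<in> subgroup_data"
  shows "x \<in> carrier R" "S \<subseteq> carrier R" "PI (p - 1) \<subseteq> S" "0 \<in> K" "K \<subseteq> Cyc" "\<zero> \<in> S"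
    and "\<And>s t. s \<in> S \<Longrightarrow> t \<in> S \<Longrightarrow> s \<oplus> t \<in> S" "\<And>s. s \<in> S \<Longrightarrow> \<ominus> s \<in> S"
    and "\<And>k l. k \<in> K \<Longrightarrow> l \<in> K \<Longrightarrow> (k + l) mod int p \<in> K"
    and "\<And>k. k \<in> K \<Longrightarrow> (- k) mod int p \<in> K"
  using assms subgroup.mem_carrier[of S "add_monoid R"] subgroup.one_closed[of S "add_monoid R"]
    subgroup.m_closed[of S "add_monoid R"] subgroup.m_inv_closed[of S "add_monoid R"]
  by (auto simp: subgroup_data_def a_inv_def)

lemma subgroup_data_cases:
  assumes "(x, S, K) \<in> subgroup_data"
  obtains "K = {0}" | "K = Cyc" "S \<subseteq> PI (p - 2)"
  using assms by (auto simp: subgroup_data_def)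

lemma subgroup_data_pow: "(x, S, K) \<in> subgroup_data \<Longrightarrow> s \<in> S \<Longrightarrow> add_pow R (n::nat) s \<in> S"
  using subgroup_data_D(6,7) by (induction n) auto

text \<open>The factor \<pi>[k] is \<theta>^k - 1, so this says that K acts trivially on S modulo
  \<pi>^(p-1): if K is trivial because [0] = 0, otherwise because S lies in (\<pi>^(p-2)).\<close>

lemma subgroup_data_bracket:
  assumes t: "(x, S, K) \<in> subgroup_data" and s: "s \<in> S" and k: "k \<in> K"
  shows "\<pi> \<otimes> bracket k \<otimes> s \<in> PI (p - 1)"
  using t
proof (cases rule: subgroup_data_cases)
  case 1
  then show ?thesis using k s subgroup_data_D(2)[OF t] by auto
next
  case 2
  then obtain r where "r \<in> carrier R" "s = \<pi> [^] (p - 2) \<otimes> r"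
    using s by (auto simp: PI_def)
  \<comment> \<open>Truncated subtraction is safe here because p \<ge> 2.\<close>
  moreover have "\<pi> [^] (p - 1) = \<pi> [^] (p - 2) \<otimes> \<pi>"
    using p_gt_1 nat_pow_Suc[of \<pi> "p - 2"] by (simp add: Suc_diff_Suc numeral_2_eq_2)
  ultimately have "\<pi> \<otimes> bracket k \<otimes> s = \<pi> [^] (p - 1) \<otimes> (bracket k \<otimes> r)"
    by (simp add: m_ac)
  then show ?thesis using \<open>r \<in> carrier R\<close> by auto
qed

end

text \<open>\<open>H\<close> stands for G/\<gamma>_i(G) with c = i - p, so that i - 1 = c + (p - 1);
  only the kernel of the quotient map is recorded, not the cosets. The assumption c > 0 is i \<ge> p
  + 1.\<close>

locale cyclotomic_quotient = cyclotomic_domain +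
  fixes H :: "('h, 'n) monoid_scheme" and q :: "'a \<times> int \<Rightarrow> 'h" and c :: nat
  assumes group_H: "group H"
    and q_hom: "q \<in> hom G H" and q_surj: "q ` carrier G = carrier H"
    and q_eq: "\<And>x y k l. x \<in> carrier R \<Longrightarrow> y \<in> carrier R \<Longrightarrow> k \<in> Cyc \<Longrightarrow> l \<in> Cyc \<Longrightarrow>
      q (x, k) = q (y, l) \<longleftrightarrow> k = l \<and> x \<ominus> y \<in> PI (c + (p - 1))"
    and c_pos: "c > 0"
begin

sublocale H: group H by (rule group_H)
sublocale q: group_hom G H q
  by (simp add: group_hom_def group_hom_axioms_def group_G group_H q_hom)

definition elem :: "'a \<times> 'a set \<times> int set \<Rightarrow> 'a \<times> int \<Rightarrow> 'h"
  where "elem = (\<lambda>(x, S, K) (s, k). q (x \<otimes> bracket k \<oplus> \<pi> [^] c \<otimes> s, k))"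

lemma elem_apply: "elem (x, S, K) (s, k) = q (x \<otimes> bracket k \<oplus> \<pi> [^] c \<otimes> s, k)"
  by (simp add: elem_def)

lemma q_mult:
  assumes "x \<in> carrier R" "y \<in> carrier R" "k \<in> Cyc" "l \<in> Cyc"
  shows "q (x, k) \<otimes>\<^bsub>H\<^esub> q (y, l) = q (x \<oplus> \<theta>p k \<otimes> y, (k + l) mod int p)"
  using assms q.hom_mult[of "(x, k)" "(y, l)"] by simp

lemma q_one: "q (\<zero>, 0) = \<one>\<^bsub>H\<^esub>"
  using q.hom_one by simp

lemma q_closed: "x \<in> carrier R \<Longrightarrow> k \<in> Cyc \<Longrightarrow> q (x, k) \<in> carrier H"
  using q.hom_closed[of "(x, k)"] by simp

lemma q_conj:
  assumes "y \<in> carrier R" "j \<in> Cyc" "a \<in> carrier R" "k \<in> Cyc"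
  shows "q (y, j) \<otimes>\<^bsub>H\<^esub> q (a, k) \<otimes>\<^bsub>H\<^esub> inv\<^bsub>H\<^esub> q (y, j) = q (\<theta>p j \<otimes> a \<ominus> \<pi> \<otimes> y \<otimes> bracket k, k)"
  using assms G_conj[OF assms] q.hom_mult[of "(y, j)" "(a, k)"]
    q.hom_mult[of "(y, j) \<otimes>\<^bsub>G\<^esub> (a, k)" "inv\<^bsub>G\<^esub> (y, j)"] q.hom_inv[of "(y, j)"]
    G.m_closed[of "(y, j)" "(a, k)"] G.inv_closed[of "(y, j)"]
  by (simp del: G_mult)

lemma q_eqI:
  assumes "x \<in> carrier R" "k \<in> Cyc" "d \<in> PI (p - 1)" "y = x \<oplus> \<pi> [^] c \<otimes> d"
  shows "q (y, k) = q (x, k)"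
proof -
  have d: "\<pi> [^] c \<otimes> d \<in> PI (c + (p - 1))" "d \<in> carrier R"
    using assms PI_shift PI_closed by auto
  have "y \<ominus> x = \<pi> [^] c \<otimes> d"
    using assms(1) PI_closed[OF d(1)] unfolding assms(4) by algebra
  with d assms show ?thesis by (subst q_eq) auto
qed

text \<open>Membership of a class can be tested on any representative \<open>a\<close>, because S
  contains \<pi>^(p-1) R and absorbs a discrepancy from the kernel.\<close>

lemma elem_image_iff:
  assumes t: "(x, S, K) \<in> subgroup_data" and a: "a \<in> carrier R" "k \<in> Cyc"
  shows "q (a, k) \<in> elem (x, S, K) ` coords (x, S, K) \<longleftrightarrow> k \<in> K \<and> (\<exists>s\<in>S. a = x \<otimes> bracket k \<oplus> \<pi> [^] c \<otimes> s)"
proof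
  note T = subgroup_data_D[OF t]
  assume "q (a, k) \<in> elem (x, S, K) ` coords (x, S, K)"
  then obtain s l where s: "s \<in> S" "l \<in> K" and "q (a, k) = q (x \<otimes> bracket l \<oplus> \<pi> [^] c \<otimes> s, l)"
    by (auto simp: coords_def elem_def)
  then have k: "k = l" and "a \<ominus> (x \<otimes> bracket k \<oplus> \<pi> [^] c \<otimes> s) \<in> PI (c + (p - 1))"
    using a T(1) subsetD[OF T(2)] subsetD[OF T(5)] q_eq[of a "x \<otimes> bracket l \<oplus> \<pi> [^] c \<otimes> s" k l]
    by auto
  then obtain r where r: "r \<in> carrier R" "a \<ominus> (x \<otimes> bracket k \<oplus> \<pi> [^] c \<otimes> s) = \<pi> [^] c \<otimes> (\<pi> [^] (p - 1) \<otimes> r)"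
    by (auto simp: PI_def m_assoc simp flip: nat_pow_mult)
  let ?d = "\<pi> [^] (p - 1) \<otimes> r"
  have d: "?d \<in> S" using T r by auto
  have sc: "s \<in> carrier R" "?d \<in> carrier R" "\<pi> [^] c \<in> carrier R" "bracket k \<in> carrier R"
    using s T d by auto
  have "a = (x \<otimes> bracket k \<oplus> \<pi> [^] c \<otimes> s) \<oplus> (a \<ominus> (x \<otimes> bracket k \<oplus> \<pi> [^] c \<otimes> s))"
    using a sc T(1) by algebra
  also have "\<dots> = x \<otimes> bracket k \<oplus> \<pi> [^] c \<otimes> (s \<oplus> ?d)"
    unfolding r(2) using sc T(1) by (simp add: r_distr a_assoc)
  finally show "k \<in> K \<and> (\<exists>s\<in>S. a = x \<otimes> bracket k \<oplus> \<pi> [^] c \<otimes> s)"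
    using k s T(7)[OF s(1) d] by blast
next
  assume "k \<in> K \<and> (\<exists>s\<in>S. a = x \<otimes> bracket k \<oplus> \<pi> [^] c \<otimes> s)"
  then obtain s where "k \<in> K" "s \<in> S" "a = x \<otimes> bracket k \<oplus> \<pi> [^] c \<otimes> s" by blast
  then show "q (a, k) \<in> elem (x, S, K) ` coords (x, S, K)"
    by (intro image_eqI[of _ _ "(s, k)"]) (auto simp: coords_def elem_def)
qed

text \<open>The criterion for two parameters to give the same element does not involve c; this is
  what allows coordinates to be carried from one quotient to another.\<close>

lemma elem_eq_iff:
  assumes t: "(x, S, K) \<in> subgroup_data" and "s \<in> S" "s' \<in> S" "k \<in> K" "k' \<in> K"
  shows "elem (x, S, K) (s, k) = elem (x, S, K) (s', k') \<longleftrightarrow> k = k' \<and> s \<ominus> s' \<in> PI (p - 1)"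
proof -
  note T = subgroup_data_D[OF t]
  have *: "s \<in> carrier R" "s' \<in> carrier R" "k \<in> Cyc" "k' \<in> Cyc" "\<pi> [^] c \<in> carrier R" "bracket k' \<in> carrier R"
    using T assms by auto
  have "(x \<otimes> bracket k' \<oplus> \<pi> [^] c \<otimes> s) \<ominus> (x \<otimes> bracket k' \<oplus> \<pi> [^] c \<otimes> s') = \<pi> [^] c \<otimes> (s \<ominus> s')"
    using * T(1) by algebra
  then show ?thesis
    using * T(1) by (auto simp: elem_def q_eq PI_shift)
qed

text \<open>The cocycle identity merges x[k] + \<theta>^k x[k'] into x[k + k'], and \<theta>^k s'
  may be replaced by s' by \<open>subgroup_data_bracket\<close>. In coordinates the twisted product
  is thus componentwise addition.\<close>

lemma elem_mult:
  assumes t: "(x, S, K) \<in> subgroup_data" and "s \<in> S" "s' \<in> S" "k \<in> K" "k' \<in> K"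
  shows "elem (x, S, K) (s, k) \<otimes>\<^bsub>H\<^esub> elem (x, S, K) (s', k') = elem (x, S, K) (s \<oplus> s', (k + k') mod int p)"
proof -
  note T = subgroup_data_D[OF t]
  have *: "s \<in> carrier R" "s' \<in> carrier R" "k \<in> Cyc" "k' \<in> Cyc" "\<pi> [^] c \<in> carrier R"
     "bracket k \<in> carrier R" "bracket k' \<in> carrier R"
    using T assms by auto
  have "x \<otimes> bracket k \<oplus> \<pi> [^] c \<otimes> s \<oplus> \<theta>p k \<otimes> (x \<otimes> bracket k' \<oplus> \<pi> [^] c \<otimes> s') =
      x \<otimes> (bracket k \<oplus> \<theta>p k \<otimes> bracket k') \<oplus> \<pi> [^] c \<otimes> (s \<oplus> \<theta>p k \<otimes> s')"
    using * T(1) by (simp add: r_distr a_ac m_ac)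
  also have "\<dots> = x \<otimes> bracket ((k + k') mod int p) \<oplus> \<pi> [^] c \<otimes> (s \<oplus> (\<one> \<oplus> \<pi> \<otimes> bracket k) \<otimes> s')"
    using * by (simp add: bracket_add Cyc_nonneg \<theta>p_eq[symmetric])
  also have "\<dots> = (x \<otimes> bracket ((k + k') mod int p) \<oplus> \<pi> [^] c \<otimes> (s \<oplus> s')) \<oplus> \<pi> [^] c \<otimes> (\<pi> \<otimes> bracket k \<otimes> s')"
    using * T(1) by (simp add: l_distr r_distr a_assoc)
  finally show ?thesis
    unfolding elem_apply using * T(1) assms
    by (subst q_mult) (auto intro!: q_eqI[OF _ _ subgroup_data_bracket[OF t assms(3,4)]])
qed

lemma elem_zero: "(x, S, K) \<in> subgroup_data \<Longrightarrow> elem (x, S, K) (\<zero>, 0) = \<one>\<^bsub>H\<^esub>"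
  using subgroup_data_D(1)[of x S K] by (simp add: elem_def q_one)

lemma elem_closed: "(x, S, K) \<in> subgroup_data \<Longrightarrow> s \<in> S \<Longrightarrow> k \<in> K \<Longrightarrow> elem (x, S, K) (s, k) \<in> carrier H"
  using subgroup_data_D(1,2,5)[of x S K] unfolding elem_apply by (intro q_closed) auto

lemma elem_pow:
  assumes t: "(x, S, K) \<in> subgroup_data" and s: "s \<in> S" and k: "k \<in> K"
  shows "(int n * k) mod int p \<in> K \<and>
    elem (x, S, K) (s, k) [^]\<^bsub>H\<^esub> n = elem (x, S, K) (add_pow R n s, (int n * k) mod int p)"
proof (induction n)
  case 0
  show ?case using subgroup_data_D(4)[OF t] elem_zero[OF t] by simp
next
  case (Suc n)
  have "(int n * k mod int p + k) mod int p = int (Suc n) * k mod int p"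
    by (simp add: mod_simps algebra_simps)
  moreover have "(int n * k mod int p + k) mod int p \<in> K"
    using subgroup_data_D(9)[OF t] Suc k by blast
  ultimately show ?case
    using Suc elem_mult[OF t subgroup_data_pow[OF t s, of n] s _ k] by simp
qed

text \<open>Closure, inverses and commutativity are inherited from componentwise addition of
  coordinates. The exponent is p because pS lies in (\<pi>^(p-1)) and pk vanishes modulo p.\<close>

lemma elem_elementary:
  assumes t: "(x, S, K) \<in> subgroup_data"
  shows "elementary_abelian_subgroup p H (elem (x, S, K) ` coords (x, S, K))"
proof -
  note T = subgroup_data_D[OF t]
  let ?E = "elem (x, S, K) ` coords (x, S, K)"
  have E: "u \<in> ?E \<longleftrightarrow> (\<exists>s\<in>S. \<exists>k\<in>K. u = elem (x, S, K) (s, k))" for u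
    by (auto simp: coords_def)
  have sub: "subgroup ?E H"
  proof (rule H.subgroupI)
    show "?E \<subseteq> carrier H" using elem_closed[OF t] by (auto simp: coords_def)
    show "?E \<noteq> {}" using T by (auto simp: coords_def)
  next
    fix u assume "u \<in> ?E"
    then obtain s k where sk: "s \<in> S" "k \<in> K" "u = elem (x, S, K) (s, k)" unfolding E by blast
    have "elem (x, S, K) (\<ominus> s, (- k) mod int p) \<otimes>\<^bsub>H\<^esub> u = \<one>\<^bsub>H\<^esub>"
      using elem_mult[OF t T(8)[OF sk(1)] sk(1) T(10)[OF sk(2)] sk(2)] elem_zero[OF t] T(2) sk
      by (simp add: l_neg subset_iff mod_simps)
    then have "inv\<^bsub>H\<^esub> u = elem (x, S, K) (\<ominus> s, (- k) mod int p)"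
      using H.inv_equality elem_closed[OF t] T(8,10) sk by simp
    then show "inv\<^bsub>H\<^esub> u \<in> ?E" unfolding E using T(8,10) sk by blast
  next
    fix u v assume "u \<in> ?E" "v \<in> ?E"
    then show "u \<otimes>\<^bsub>H\<^esub> v \<in> ?E" unfolding E using elem_mult[OF t] T(7,9) by metis
  qed
  moreover have "comm_group (H\<lparr>carrier := ?E\<rparr>)"
  proof (rule group.group_comm_groupI)
    show "group (H\<lparr>carrier := ?E\<rparr>)" using subgroup.subgroup_is_group[OF sub group_H] .
    fix u v assume "u \<in> carrier (H\<lparr>carrier := ?E\<rparr>)" "v \<in> carrier (H\<lparr>carrier := ?E\<rparr>)"
    then obtain s k s' k' where "s \<in> S" "k \<in> K" "u = elem (x, S, K) (s, k)"
      "s' \<in> S" "k' \<in> K" "v = elem (x, S, K) (s', k')" by (auto simp: coords_def)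
    then show "u \<otimes>\<^bsub>H\<lparr>carrier := ?E\<rparr>\<^esub> v = v \<otimes>\<^bsub>H\<lparr>carrier := ?E\<rparr>\<^esub> u"
      using elem_mult[OF t, of s s' k k'] elem_mult[OF t, of s' s k' k] T(2)
      by (simp add: a_comm add.commute subset_iff)
  qed
  moreover have "\<forall>u\<in>?E. u [^]\<^bsub>H\<^esub> p = \<one>\<^bsub>H\<^esub>"
  proof
    fix u assume "u \<in> ?E"
    then obtain s k where sk: "s \<in> S" "k \<in> K" "u = elem (x, S, K) (s, k)" unfolding E by blast
    then have "u [^]\<^bsub>H\<^esub> p = elem (x, S, K) (add_pow R p s, 0)"
      using elem_pow[OF t sk(1,2), of p] by simp
    also have "\<dots> = elem (x, S, K) (\<zero>, 0)"
      using elem_eq_iff[OF t subgroup_data_pow[OF t sk(1)] T(6) T(4) T(4)] p_mult_PI[of s] T(2) sk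
      by (auto simp: a_minus_def)
    finally show "u [^]\<^bsub>H\<^esub> p = \<one>\<^bsub>H\<^esub>" by (simp add: elem_zero[OF t])
  qed
  ultimately show ?thesis by (simp add: elementary_abelian_subgroup_def)
qed

end

section \<open>Classification of the elementary abelian subgroups\<close>

context cyclotomic_quotient
begin

lemma q_pow_0: "a \<in> carrier R \<Longrightarrow> q (a, 0) [^]\<^bsub>H\<^esub> (n::nat) = q (add_pow R n a, 0)"
  by (induction n) (auto simp: q_one q_mult)

text \<open>This is where the brackets come from: the n-th power of (x, 1) has first component x +
  \<theta>x + ... + \<theta>^(n-1) x = x[n].\<close>

lemma q_pow_1: "x \<in> carrier R \<Longrightarrow> q (x, 1) [^]\<^bsub>H\<^esub> (n::nat) = q (x \<otimes> bracket (int n mod int p), int n mod int p)"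
proof (induction n)
  case (Suc n)
  have *: "(int n mod int p + 1) mod int p = int (Suc n) mod int p"
    by (simp add: mod_simps add.commute)
  have "bracket (int (Suc n) mod int p) = bracket (int n mod int p) \<oplus> \<theta>p (int n mod int p)"
    using bracket_add[of "int n mod int p" 1] p_gt_1 unfolding * by simp
  then show ?case
    using Suc * by (simp add: q_mult r_distr m_comm del: of_nat_Suc)
qed (simp add: q_one)

lemma q_pow_snd:
  assumes "a \<in> carrier R" "k \<in> Cyc"
  shows "\<exists>b\<in>carrier R. q (a, k) [^]\<^bsub>H\<^esub> (n::nat) = q (b, (int n * k) mod int p)"
proof (induction n)
  case 0
  then show ?case by (intro bexI[of _ \<zero>]) (auto simp: q_one)
next
  case (Suc n)
  then obtain b where b: "b \<in> carrier R" "q (a, k) [^]\<^bsub>H\<^esub> n = q (b, (int n * k) mod int p)" by blast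
  have "(int n * k mod int p + k) mod int p = int (Suc n) * k mod int p"
    by (simp add: mod_simps algebra_simps)
  then show ?case
    using b assms by (intro bexI[of _ "b \<oplus> \<theta>p ((int n * k) mod int p) \<otimes> a"]) (auto simp: q_mult)
qed

lemma q_cases:
  assumes "u \<in> carrier H"
  obtains a k where "a \<in> carrier R" "k \<in> Cyc" "u = q (a, k)"
  using assms unfolding q_surj[symmetric] by (auto simp: G_carrier)

text \<open>\<open>S\<close> records the part of E over k = 0, divided by \<pi>^c. If E has an
  element over some k \<noteq> 0, a power of it lies over 1, and the powers of that one supply an
  element of E over every k; the rest of E is then determined by \<open>S\<close>.\<close>

lemma elementary_cases:
  assumes E: "elementary_abelian_subgroup p H E"
  shows "\<exists>t\<in>subgroup_data. E = elem t ` coords t"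
proof -
  have sub: "subgroup E H" and comm: "comm_group (H\<lparr>carrier := E\<rparr>)"
    and exponent: "\<And>u. u \<in> E \<Longrightarrow> u [^]\<^bsub>H\<^esub> p = \<one>\<^bsub>H\<^esub>"
    using E by (auto simp: elementary_abelian_subgroup_def)
  interpret E: subgroup E H by (rule sub)
  define S where "S = {s \<in> carrier R. q (\<pi> [^] c \<otimes> s, 0) \<in> E}"
  have S_R: "S \<subseteq> carrier R" by (auto simp: S_def)
  have S_sub: "subgroup S (add_monoid R)"
  proof (rule add.subgroupI)
    show "S \<noteq> {}" using q_one by (auto simp: S_def intro!: exI[of _ \<zero>])
  next
    fix s assume s: "s \<in> S"
    then have "q (\<pi> [^] c \<otimes> \<ominus> s, 0) = inv\<^bsub>H\<^esub> q (\<pi> [^] c \<otimes> s, 0)"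
      using q.hom_inv[of "(\<pi> [^] c \<otimes> s, 0)"] by (simp add: G_inv_0 r_minus S_def)
    then show "\<ominus> s \<in> S"
      using s by (simp add: S_def)
  next
    fix s t assume st: "s \<in> S" "t \<in> S"
    then have "q (\<pi> [^] c \<otimes> (s \<oplus> t), 0) = q (\<pi> [^] c \<otimes> s, 0) \<otimes>\<^bsub>H\<^esub> q (\<pi> [^] c \<otimes> t, 0)"
      by (simp add: q_mult r_distr S_def)
    then show "s \<oplus> t \<in> S"
      using st by (simp add: S_def)
  qed (rule S_R)
  have PI_S: "PI (p - 1) \<subseteq> S"
  proof
    fix d assume d: "d \<in> PI (p - 1)"
    then have "q (\<pi> [^] c \<otimes> d, 0) = q (\<zero>, 0)"
      by (intro q_eqI) (auto simp: PI_closed)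
    then show "d \<in> S" using d q_one by (auto simp: S_def PI_closed)
  qed
  \<comment> \<open>An element of E over k = 0 is killed by p, so \<open>p_torsion\<close> makes it
    a multiple of \<pi>^c, and \<open>S\<close> misses none of them.\<close>
  have torsion: "(\<exists>s\<in>S. a = \<pi> [^] c \<otimes> s) \<longleftrightarrow> q (a, 0) \<in> E" if a: "a \<in> carrier R" for a
  proof
    assume E: "q (a, 0) \<in> E"
    have "q (add_pow R p a, 0) = q (\<zero>, 0)"
      using exponent[OF E] by (simp add: q_pow_0 a q_one)
    then have "add_pow R p a \<in> PI (c + (p - 1))"
      using a by (subst (asm) q_eq) (auto simp: a_minus_def)
    then obtain s where "s \<in> carrier R" "a = \<pi> [^] c \<otimes> s"
      using p_torsion[OF a] by (auto simp: PI_def)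
    then show "\<exists>s\<in>S. a = \<pi> [^] c \<otimes> s" using E by (auto simp: S_def)
  qed (auto simp: S_def)
  have eqI: "E = elem t ` coords t" if t: "t \<in> subgroup_data"
    and *: "\<And>a k. a \<in> carrier R \<Longrightarrow> k \<in> Cyc \<Longrightarrow> q (a, k) \<in> E \<longleftrightarrow> q (a, k) \<in> elem t ` coords t" for t
  proof -
    have "elem t ` coords t \<subseteq> carrier H"
      using elem_elementary[of "fst t" "fst (snd t)" "snd (snd t)"] t
      by (auto simp: elementary_abelian_subgroup_def dest: subgroup.subset)
    moreover have "u \<in> E \<longleftrightarrow> u \<in> elem t ` coords t" if "u \<in> carrier H" for u
      using * that by (elim q_cases) simp
    ultimately show ?thesis using E.subset by blast
  qed
  show ?thesis
  proof (cases "\<forall>a\<in>carrier R. \<forall>k\<in>Cyc. q (a, k) \<in> E \<longrightarrow> k = 0")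
    case True
    \<comment> \<open>Any x would present the same subgroup, since [0] = 0.\<close>
    have t: "(\<zero>, S, {0}) \<in> subgroup_data" using S_sub PI_S by (simp add: subgroup_data_def)
    have "E = elem (\<zero>, S, {0}) ` coords (\<zero>, S, {0})"
    proof (rule eqI[OF t])
      fix a k assume a: "a \<in> carrier R" "k \<in> Cyc"
      have "q (a, k) \<in> E \<longleftrightarrow> k = 0 \<and> (\<exists>s\<in>S. a = \<pi> [^] c \<otimes> s)"
        using True a torsion[OF a(1)] by auto
      also have "\<dots> \<longleftrightarrow> k \<in> {0} \<and> (\<exists>s\<in>S. a = \<zero> \<otimes> bracket k \<oplus> \<pi> [^] c \<otimes> s)"
        using S_R by (auto simp: subset_iff)
      finally show "q (a, k) \<in> E \<longleftrightarrow> q (a, k) \<in> elem (\<zero>, S, {0}) ` coords (\<zero>, S, {0})"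
        by (simp only: elem_image_iff[OF t a])
    qed
    with t show ?thesis by blast
  next
    case False
    then obtain a k where a: "a \<in> carrier R" "k \<in> Cyc" "q (a, k) \<in> E" "k \<noteq> 0" by auto
    \<comment> \<open>An inverse u of k modulo p gives the exponent that moves (a, k) to an element
      over 1.\<close>
    have "\<not> int p dvd k"
      using a(2,4) by (simp add: Cyc_def zdvd_not_zless)
    moreover have "Factorial_Ring.prime (int p)" using prime by simp
    ultimately have "coprime k (int p)"
      using prime_imp_coprime coprime_commute by blast
    then obtain u v where uv: "u * k + v * int p = 1"
      using bezout_int[of k "int p"] by auto
    have "(u mod int p) * k mod int p = (u * k + v * int p) mod int p"
      by (simp add: mod_simps)
    then have "int (nat (u mod int p)) * k mod int p = 1"
      using uv p_gt_1 by simp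
    then obtain x where x: "x \<in> carrier R" "q (a, k) [^]\<^bsub>H\<^esub> nat (u mod int p) = q (x, 1)"
      using q_pow_snd[OF a(1,2), of "nat (u mod int p)"] by metis
    have pow_E: "w [^]\<^bsub>H\<^esub> (n::nat) \<in> E" if "w \<in> E" for w n
      using that by (induction n) auto
    have x_E: "q (x, 1) \<in> E" using pow_E[OF a(3)] x(2) by metis
    have line: "q (x \<otimes> bracket k, k) \<in> E" if "k \<in> Cyc" for k
      using pow_E[OF x_E, of "nat k"] that
      by (simp only: q_pow_1[OF x(1)] nat_0_le Cyc_nonneg Cyc_mod_self)
    \<comment> \<open>Commuting with (x, 1) means that \<theta> fixes \<pi>^c s modulo
      \<pi>^(c+p-1), that is, \<pi>^(c+1) s vanishes there. As c + (p - 1) = (c + 1) + (p - 2),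
      cancelling \<pi>^(c+1) leaves the exponent p - 2.\<close>
    have "S \<subseteq> PI (p - 2)"
    proof
      fix s assume s: "s \<in> S"
      then have sR: "s \<in> carrier R" "q (\<pi> [^] c \<otimes> s, 0) \<in> E" by (auto simp: S_def)
      have "q (\<pi> [^] c \<otimes> s, 0) \<otimes>\<^bsub>H\<^esub> q (x, 1) = q (x, 1) \<otimes>\<^bsub>H\<^esub> q (\<pi> [^] c \<otimes> s, 0)"
        using comm_groupE(4)[OF comm, of "q (\<pi> [^] c \<otimes> s, 0)" "q (x, 1)"] sR x_E by simp
      then have "q (x \<oplus> \<theta>p 1 \<otimes> (\<pi> [^] c \<otimes> s), 1) = q (\<pi> [^] c \<otimes> s \<oplus> x, 1)"
        using sR x(1) p_gt_1 by (simp add: q_mult)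
      then have "x \<oplus> \<theta>p 1 \<otimes> (\<pi> [^] c \<otimes> s) \<ominus> (\<pi> [^] c \<otimes> s \<oplus> x) \<in> PI (c + (p - 1))"
        using sR x(1) by (simp add: q_eq)
      also have "x \<oplus> \<theta>p 1 \<otimes> (\<pi> [^] c \<otimes> s) \<ominus> (\<pi> [^] c \<otimes> s \<oplus> x) = \<pi> \<otimes> (\<pi> [^] c \<otimes> s)"
      proof -
        have *: "\<pi> [^] c \<otimes> s \<in> carrier R" using sR by simp
        show ?thesis unfolding \<theta>p_eq bracket_1 using x(1) * \<pi>_closed one_closed by algebra
      qed
      also have "\<dots> = \<pi> [^] Suc c \<otimes> s" using sR by (simp add: m_ac)
      also have "c + (p - 1) = Suc c + (p - 2)" using p_gt_1 by simp
      finally show "s \<in> PI (p - 2)" using PI_shift[OF sR(1), of "Suc c" "p - 2"] by metis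
    qed
    then have t: "(x, S, Cyc) \<in> subgroup_data" using S_sub PI_S x by (simp add: subgroup_data_def)
    have "E = elem (x, S, Cyc) ` coords (x, S, Cyc)"
    proof (rule eqI[OF t])
      fix a k assume a: "a \<in> carrier R" "k \<in> Cyc"
      let ?l = "q (x \<otimes> bracket k, k)"
      have xk: "x \<otimes> bracket k \<in> carrier R" using x by simp
      have d: "a \<ominus> x \<otimes> bracket k \<in> carrier R" using a x by simp
      have "a = (a \<ominus> x \<otimes> bracket k) \<oplus> x \<otimes> bracket k"
        using a(1) xk by algebra
      \<comment> \<open>Dividing by the element x[k] of E over k moves the question to k = 0, where
        \<open>torsion\<close> answers it.\<close>
      then have prod: "q (a, k) = q (a \<ominus> x \<otimes> bracket k, 0) \<otimes>\<^bsub>H\<^esub> ?l"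
        using a xk d by (simp add: q_mult Cyc_mod_self)
      have "q (a, k) \<in> E \<longleftrightarrow> q (a \<ominus> x \<otimes> bracket k, 0) \<in> E"
      proof
        assume "q (a, k) \<in> E"
        then have "q (a, k) \<otimes>\<^bsub>H\<^esub> inv\<^bsub>H\<^esub> ?l \<in> E" using line[OF a(2)] by blast
        also have "q (a, k) \<otimes>\<^bsub>H\<^esub> inv\<^bsub>H\<^esub> ?l = q (a \<ominus> x \<otimes> bracket k, 0)"
          using H.inv_solve_right'[of "q (a \<ominus> x \<otimes> bracket k, 0)" "q (a, k)" ?l] prod
            q_closed a xk d by simp
        finally show "q (a \<ominus> x \<otimes> bracket k, 0) \<in> E" .
      qed (use prod line[OF a(2)] in simp)
      also have "\<dots> \<longleftrightarrow> (\<exists>s\<in>S. a \<ominus> x \<otimes> bracket k = \<pi> [^] c \<otimes> s)"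
        using torsion[OF d] by simp
      also have "\<dots> \<longleftrightarrow> k \<in> Cyc \<and> (\<exists>s\<in>S. a = x \<otimes> bracket k \<oplus> \<pi> [^] c \<otimes> s)"
      proof -
        have "a \<ominus> x \<otimes> bracket k = \<pi> [^] c \<otimes> s \<longleftrightarrow> a = x \<otimes> bracket k \<oplus> \<pi> [^] c \<otimes> s"
          if "s \<in> S" for s
        proof -
          have *: "\<pi> [^] c \<otimes> s \<in> carrier R" using that S_R by auto
          show ?thesis
          proof
            assume "a \<ominus> x \<otimes> bracket k = \<pi> [^] c \<otimes> s"
            then show "a = x \<otimes> bracket k \<oplus> \<pi> [^] c \<otimes> s"
              using \<open>a = (a \<ominus> x \<otimes> bracket k) \<oplus> x \<otimes> bracket k\<close> * xk by (simp add: a_comm)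
          next
            assume "a = x \<otimes> bracket k \<oplus> \<pi> [^] c \<otimes> s"
            then show "a \<ominus> x \<otimes> bracket k = \<pi> [^] c \<otimes> s"
              using * xk by simp algebra
          qed
        qed
        then show ?thesis using a(2) by blast
      qed
      finally show "q (a, k) \<in> E \<longleftrightarrow> q (a, k) \<in> elem (x, S, Cyc) ` coords (x, S, Cyc)"
        by (simp only: elem_image_iff[OF t a])
    qed
    with t show ?thesis by blast
  qed
qed

lemma objects: "(\<lambda>t. elem t ` coords t) ` subgroup_data = Obj (quillen_category p H)"
  using elementary_cases elem_elementary by (fastforce simp: quillen_category_def)

section \<open>Conjugation in coordinates\<close>

lemma elem_conj:
  assumes t: "(x, S, K) \<in> subgroup_data" and "s \<in> S" "k \<in> K" and y: "y \<in> carrier R" and j: "j \<in> Cyc"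
  shows "q (y, j) \<otimes>\<^bsub>H\<^esub> elem (x, S, K) (s, k) \<otimes>\<^bsub>H\<^esub> inv\<^bsub>H\<^esub> q (y, j) =
    q ((\<theta>p j \<otimes> x \<ominus> \<pi> \<otimes> y) \<otimes> bracket k \<oplus> \<pi> [^] c \<otimes> (\<theta>p j \<otimes> s), k)"
proof -
  have *: "x \<in> carrier R" "s \<in> carrier R" "k \<in> Cyc" "\<theta>p j \<in> carrier R" "\<pi> [^] c \<in> carrier R"
    using subgroup_data_D[OF t] assms by auto
  have "\<theta>p j \<otimes> (x \<otimes> bracket k \<oplus> \<pi> [^] c \<otimes> s) \<ominus> \<pi> \<otimes> y \<otimes> bracket k =
      (\<theta>p j \<otimes> x \<ominus> \<pi> \<otimes> y) \<otimes> bracket k \<oplus> \<pi> [^] c \<otimes> (\<theta>p j \<otimes> s)"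
    using * y \<pi>_closed bracket_closed[of k] by algebra
  then show ?thesis
    unfolding elem_apply using * y j by (subst q_conj) simp_all
qed

text \<open>Both directions turn on \<theta>^j x - \<pi>y = x' + \<pi>^c \<sigma>. A conjugating
  element gives y, and the image of the point over k = 1 yields \<sigma>; conversely, given
  \<sigma>, the equation is solvable for y because x and x' agree modulo \<pi>, as do \<theta>^j and
  1, and c > 0. If K is trivial, the base points are invisible and no equation arises.\<close>

lemma morphism_iff:
  assumes t: "t \<in> subgroup_data" and t': "t' \<in> subgroup_data"
  shows "f \<in> Hom (quillen_category p H) (elem t ` coords t) (elem t' ` coords t') \<longleftrightarrow>
    f \<in> extensional (elem t ` coords t) \<and> (\<exists>m\<in>coord_maps t t'. \<forall>a\<in>coords t. f (elem t a) = elem t' (m a))" (is "?L \<longleftrightarrow> ?Rh")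
proof -
  obtain x S K x' S' K' where tt: "t = (x, S, K)" "t' = (x', S', K')"
    by (cases t; cases t') auto
  note t = t[unfolded tt] and t' = t'[unfolded tt]
  note T = subgroup_data_D[OF t] and T' = subgroup_data_D[OF t']
  let ?E = "elem t ` coords t" and ?E' = "elem t' ` coords t'"
  have Hom: "?L \<longleftrightarrow> (\<exists>h\<in>carrier H. f = restrict (\<lambda>u. h \<otimes>\<^bsub>H\<^esub> u \<otimes>\<^bsub>H\<^esub> inv\<^bsub>H\<^esub> h) ?E \<and>
      (\<forall>u\<in>?E. h \<otimes>\<^bsub>H\<^esub> u \<otimes>\<^bsub>H\<^esub> inv\<^bsub>H\<^esub> h \<in> ?E'))"
    unfolding quillen_category_def by (simp only: category.simps mem_Collect_eq image_subset_iff) blast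
  have pic: "\<pi> [^] c = \<pi> \<otimes> \<pi> [^] (c - 1)"
    using c_pos nat_pow_Suc[of \<pi> "c - 1"] by (simp add: m_comm)
  show ?thesis
  proof
    assume ?L
    then obtain h where h: "h \<in> carrier H" "f = restrict (\<lambda>u. h \<otimes>\<^bsub>H\<^esub> u \<otimes>\<^bsub>H\<^esub> inv\<^bsub>H\<^esub> h) ?E"
      and maps: "\<And>u. u \<in> ?E \<Longrightarrow> h \<otimes>\<^bsub>H\<^esub> u \<otimes>\<^bsub>H\<^esub> inv\<^bsub>H\<^esub> h \<in> ?E'"
      unfolding Hom by blast
    obtain y j where y: "y \<in> carrier R" "j \<in> Cyc" "h = q (y, j)" using q_cases[OF h(1)] .
    define z where "z = \<theta>p j \<otimes> x \<ominus> \<pi> \<otimes> y"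
    have z: "z \<in> carrier R" using T y by (simp add: z_def)
    have f: "f (elem t (s, k)) = q (z \<otimes> bracket k \<oplus> \<pi> [^] c \<otimes> (\<theta>p j \<otimes> s), k)" if "s \<in> S" "k \<in> K" for s k
      using elem_conj[OF t that y(1,2)] that h y unfolding tt z_def by (auto simp: coords_def)
    have mem: "k \<in> K' \<and> (\<exists>s'\<in>S'. z \<otimes> bracket k \<oplus> \<pi> [^] c \<otimes> (\<theta>p j \<otimes> s) = x' \<otimes> bracket k \<oplus> \<pi> [^] c \<otimes> s')"
      if "s \<in> S" "k \<in> K" for s k
    proof -
      have "elem t (s, k) \<in> ?E" using that by (auto simp: tt coords_def)
      then have "f (elem t (s, k)) \<in> ?E'" using maps h(2) by simp
      then have "q (z \<otimes> bracket k \<oplus> \<pi> [^] c \<otimes> (\<theta>p j \<otimes> s), k) \<in> elem (x', S', K') ` coords (x', S', K')"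
        unfolding f[OF that] by (simp only: tt)
      moreover have "z \<otimes> bracket k \<oplus> \<pi> [^] c \<otimes> (\<theta>p j \<otimes> s) \<in> carrier R" "k \<in> Cyc"
        using that T z by auto
      ultimately show ?thesis
        by (simp only: elem_image_iff[OF t'])
    qed
    \<comment> \<open>Multiplying the equation by [k] lets one formula serve both cases: for K = {0}
      it reads 0 = 0, and \<sigma> = 0 serves as a default.\<close>
    have "\<exists>\<sigma>\<in>carrier R. (K = {0} \<or> x \<ominus> x' \<in> PI 1) \<and>
        (\<forall>k\<in>K. z \<otimes> bracket k = (x' \<oplus> \<pi> [^] c \<otimes> \<sigma>) \<otimes> bracket k)"
      using t
    proof (cases rule: subgroup_data_cases)
      case 1
      then show ?thesis using z T' by (intro bexI[of _ \<zero>]) auto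
    next
      case 2
      \<comment> \<open>The point with s = 0 and k = 1 is the base point itself, since [1] =
        1.\<close>
      obtain \<sigma> where \<sigma>: "\<sigma> \<in> S'" "z = x' \<oplus> \<pi> [^] c \<otimes> \<sigma>"
        using mem[OF T(6), of 1] 2 z T' by auto
      have \<sigma>R: "\<sigma> \<in> carrier R" using \<sigma> T' by auto
      have "x = \<theta>p j \<otimes> x \<ominus> \<pi> \<otimes> bracket j \<otimes> x"
        unfolding \<theta>p_eq using T(1) \<pi>_closed bracket_closed[of j] one_closed by algebra
      also have "\<theta>p j \<otimes> x = x' \<oplus> \<pi> \<otimes> (\<pi> [^] (c - 1) \<otimes> \<sigma>) \<oplus> \<pi> \<otimes> y"
      proof -
        have *: "\<theta>p j \<otimes> x \<in> carrier R" using T by simp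
        have "\<theta>p j \<otimes> x = z \<oplus> \<pi> \<otimes> y"
          unfolding z_def using * y(1) \<pi>_closed by algebra
        then show ?thesis unfolding \<sigma>(2) pic using \<sigma>R by (simp add: m_assoc)
      qed
      finally have "x \<ominus> x' = (x' \<oplus> \<pi> \<otimes> (\<pi> [^] (c - 1) \<otimes> \<sigma>) \<oplus> \<pi> \<otimes> y \<ominus> \<pi> \<otimes> bracket j \<otimes> x) \<ominus> x'"
        by simp
      also have "\<dots> = \<pi> \<otimes> (\<pi> [^] (c - 1) \<otimes> \<sigma> \<oplus> y \<ominus> bracket j \<otimes> x)"
      proof -
        have *: "\<pi> [^] (c - 1) \<otimes> \<sigma> \<in> carrier R" using \<sigma>R by simp
        show ?thesis using * y(1) T(1) T'(1) \<pi>_closed bracket_closed[of j] by algebra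
      qed
      also have "\<dots> \<in> PI 1"
        using PI_I[of "\<pi> [^] (c - 1) \<otimes> \<sigma> \<oplus> y \<ominus> bracket j \<otimes> x" 1] \<sigma>R y T by simp
      finally show ?thesis using \<sigma> \<sigma>R by blast
    qed
    then obtain \<sigma> where \<sigma>: "\<sigma> \<in> carrier R" "K = {0} \<or> x \<ominus> x' \<in> PI 1"
      and z_eq: "\<And>k. k \<in> K \<Longrightarrow> z \<otimes> bracket k = (x' \<oplus> \<pi> [^] c \<otimes> \<sigma>) \<otimes> bracket k" by blast
    define m where "m = (\<lambda>(s, k). (\<sigma> \<otimes> bracket k \<oplus> \<theta>p j \<otimes> s, k))"
    have shift: "z \<otimes> bracket k \<oplus> \<pi> [^] c \<otimes> (\<theta>p j \<otimes> s) =
        x' \<otimes> bracket k \<oplus> \<pi> [^] c \<otimes> (\<sigma> \<otimes> bracket k \<oplus> \<theta>p j \<otimes> s)" if "s \<in> S" "k \<in> K" for s k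
    proof -
      have *: "s \<in> carrier R" "\<theta>p j \<in> carrier R" "\<pi> [^] c \<in> carrier R" using that T by auto
      show ?thesis unfolding z_eq[OF that(2)]
        using * \<sigma>(1) T'(1) bracket_closed[of k] by algebra
    qed
    have "m \<in> coord_maps t t'"
      unfolding coord_maps_def tt case_prod_conv mem_Collect_eq
    proof (intro conjI bexI[of _ j] bexI[of _ \<sigma>] ballI)
      show "K \<subseteq> K'" using mem[OF T(6)] by blast
    next
      fix s k assume sk: "s \<in> S" "k \<in> K"
      then obtain s' where s': "s' \<in> S'"
        "x' \<otimes> bracket k \<oplus> \<pi> [^] c \<otimes> (\<sigma> \<otimes> bracket k \<oplus> \<theta>p j \<otimes> s) = x' \<otimes> bracket k \<oplus> \<pi> [^] c \<otimes> s'"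
        using mem[OF sk] unfolding shift[OF sk] by blast
      have "s \<in> carrier R" "s' \<in> carrier R" using sk s' T(2) T'(2) by auto
      then have "\<sigma> \<otimes> bracket k \<oplus> \<theta>p j \<otimes> s = s'"
        using s'(2) \<sigma>(1) T'(1) by (simp add: \<pi>_pow_cancel)
      then show "\<sigma> \<otimes> bracket k \<oplus> \<theta>p j \<otimes> s \<in> S'" using s'(1) by simp
      show "m (s, k) = (\<sigma> \<otimes> bracket k \<oplus> \<theta>p j \<otimes> s, k)" by (simp add: m_def)
    qed (use \<sigma> y in auto)
    moreover have "f (elem t a) = elem t' (m a)" if a: "a \<in> coords t" for a
    proof -
      obtain s k where sk: "a = (s, k)" "s \<in> S" "k \<in> K" using a by (auto simp: coords_def tt)
      show ?thesis using f[OF sk(2,3)] shift[OF sk(2,3)] by (simp add: sk(1) m_def tt elem_apply)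
    qed
    moreover have "f \<in> extensional ?E" unfolding h(2) by simp
    ultimately show ?Rh by blast
  next
    assume ?Rh
    then obtain m where ext: "f \<in> extensional ?E" and m: "m \<in> coord_maps t t'" and fm: "\<And>a. a \<in> coords t \<Longrightarrow> f (elem t a) = elem t' (m a)"
      by blast
    from m obtain j \<sigma> where KK: "K \<subseteq> K'" "K = {0} \<or> x \<ominus> x' \<in> PI 1" and j: "j \<in> Cyc" and \<sigma>: "\<sigma> \<in> carrier R"
      and m_eq: "\<And>s k. s \<in> S \<Longrightarrow> k \<in> K \<Longrightarrow> \<sigma> \<otimes> bracket k \<oplus> \<theta>p j \<otimes> s \<in> S' \<and>
        m (s, k) = (\<sigma> \<otimes> bracket k \<oplus> \<theta>p j \<otimes> s, k)"
      unfolding coord_maps_def tt case_prod_conv by blast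
    have "\<exists>y\<in>carrier R. \<forall>k\<in>K. (\<theta>p j \<otimes> x \<ominus> \<pi> \<otimes> y) \<otimes> bracket k = (x' \<oplus> \<pi> [^] c \<otimes> \<sigma>) \<otimes> bracket k"
      using KK(2)
    proof
      assume "K = {0}"
      then show ?thesis using T T' \<sigma> by (intro bexI[of _ \<zero>]) auto
    next
      assume "x \<ominus> x' \<in> PI 1"
      then obtain r where r: "r \<in> carrier R" "x \<ominus> x' = \<pi> \<otimes> r" by (auto simp: PI_def)
      \<comment> \<open>Obtained by writing \<theta>^j = 1 + \<pi>[j] and x - x' = \<pi>r in the
        equation for y and dividing by \<pi>; the division of \<pi>^c \<sigma> uses c > 0.\<close>
      let ?y = "bracket j \<otimes> x \<oplus> r \<ominus> \<pi> [^] (c - 1) \<otimes> \<sigma>"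
      have *: "\<pi> [^] (c - 1) \<in> carrier R" by simp
      have "\<theta>p j \<otimes> x \<ominus> \<pi> \<otimes> ?y = x \<ominus> \<pi> \<otimes> r \<oplus> \<pi> \<otimes> \<pi> [^] (c - 1) \<otimes> \<sigma>"
        unfolding \<theta>p_eq
        using * T(1) r(1) \<sigma> \<pi>_closed bracket_closed[of j] one_closed by algebra
      also have "\<dots> = x' \<oplus> \<pi> \<otimes> \<pi> [^] (c - 1) \<otimes> \<sigma>"
        unfolding r(2)[symmetric] using * T(1) T'(1) \<sigma> \<pi>_closed by algebra
      finally have "\<theta>p j \<otimes> x \<ominus> \<pi> \<otimes> ?y = x' \<oplus> \<pi> [^] c \<otimes> \<sigma>"
        unfolding pic .
      then show ?thesis using T r \<sigma> by (intro bexI[of _ ?y]) auto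
    qed
    then obtain y where y: "y \<in> carrier R"
      and y_eq: "\<And>k. k \<in> K \<Longrightarrow> (\<theta>p j \<otimes> x \<ominus> \<pi> \<otimes> y) \<otimes> bracket k = (x' \<oplus> \<pi> [^] c \<otimes> \<sigma>) \<otimes> bracket k" by blast
    let ?h = "q (y, j)"
    have conj: "?h \<otimes>\<^bsub>H\<^esub> elem t a \<otimes>\<^bsub>H\<^esub> inv\<^bsub>H\<^esub> ?h = elem t' (m a)" if a: "a \<in> coords t" for a
    proof -
      obtain s k where sk: "a = (s, k)" "s \<in> S" "k \<in> K" using a by (auto simp: coords_def tt)
      have *: "s \<in> carrier R" "\<theta>p j \<in> carrier R" "\<pi> [^] c \<in> carrier R" using sk T by auto
      have "(x' \<oplus> \<pi> [^] c \<otimes> \<sigma>) \<otimes> bracket k \<oplus> \<pi> [^] c \<otimes> (\<theta>p j \<otimes> s) =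
          x' \<otimes> bracket k \<oplus> \<pi> [^] c \<otimes> (\<sigma> \<otimes> bracket k \<oplus> \<theta>p j \<otimes> s)"
        using * \<sigma>(1) T'(1) bracket_closed[of k] by algebra
      then show ?thesis
        using elem_conj[OF t sk(2,3) y j] m_eq[OF sk(2,3)] y_eq[OF sk(3)]
        by (simp add: tt sk(1) elem_apply)
    qed
    have "f = restrict (\<lambda>u. ?h \<otimes>\<^bsub>H\<^esub> u \<otimes>\<^bsub>H\<^esub> inv\<^bsub>H\<^esub> ?h) ?E"
      using conj fm by (intro extensionalityI[OF ext]) auto
    moreover have "\<forall>u\<in>?E. ?h \<otimes>\<^bsub>H\<^esub> u \<otimes>\<^bsub>H\<^esub> inv\<^bsub>H\<^esub> ?h \<in> ?E'"
      using conj coord_maps_coords[OF m] by auto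
    moreover have "?h \<in> carrier H" using q_closed y j by simp
    ultimately show ?L unfolding Hom by blast
  qed
qed

end

section \<open>The quotients by the lower central series and the equivalence\<close>

lemma (in cyclotomic_domain) cyclotomic_quotient_Mod:
  assumes "c > 0"
  shows "cyclotomic_quotient R p \<theta> (G Mod (PI (c + (p - 1)) \<times> {0::int}))
    (\<lambda>g. (PI (c + (p - 1)) \<times> {0::int}) #>\<^bsub>G\<^esub> g) c"
proof -
  let ?N = "PI (c + (p - 1)) \<times> {0::int}"
  interpret N: normal ?N G by (rule PI_normal)
  show ?thesis
  proof (intro cyclotomic_quotient.intro cyclotomic_quotient_axioms.intro cyclotomic_domain_axioms)
    show "Group.group (G Mod ?N)" by (rule N.factorgroup_is_group)
    show "(\<lambda>g. ?N #>\<^bsub>G\<^esub> g) \<in> hom G (G Mod ?N)" by (rule N.r_coset_hom_Mod)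
    show "(\<lambda>g. ?N #>\<^bsub>G\<^esub> g) ` carrier G = carrier (G Mod ?N)"
      by (auto simp: FactGroup_def RCOSETS_def)
  next
    fix x y :: 'a and k l assume *: "x \<in> carrier R" "y \<in> carrier R" "k \<in> Cyc" "l \<in> Cyc"
    have "?N #>\<^bsub>G\<^esub> (x, k) = ?N #>\<^bsub>G\<^esub> (y, l) \<longleftrightarrow> (x, k) \<in> ?N #>\<^bsub>G\<^esub> (y, l)"
      using * G.repr_independence[OF _ _ PI_subgroup, of "(x, k)" "c + (p - 1)" "(y, l)"]
        G.rcos_self[OF _ PI_subgroup, of "(x, k)" "c + (p - 1)"] by auto
    also have "\<dots> \<longleftrightarrow> (\<exists>n\<in>PI (c + (p - 1)). x = n \<oplus> y) \<and> k = l"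
      using * by (auto simp: r_coset_def Cyc_mod_self)
    also have "(\<exists>n\<in>PI (c + (p - 1)). x = n \<oplus> y) \<longleftrightarrow> x \<ominus> y \<in> PI (c + (p - 1))"
    proof
      assume "\<exists>n\<in>PI (c + (p - 1)). x = n \<oplus> y"
      then obtain n where n: "n \<in> PI (c + (p - 1))" "x = n \<oplus> y" by blast
      have "x \<ominus> y = n" unfolding n(2) using PI_closed[OF n(1)] *(2) by algebra
      with n show "x \<ominus> y \<in> PI (c + (p - 1))" by simp
    next
      assume "x \<ominus> y \<in> PI (c + (p - 1))"
      moreover have "x = (x \<ominus> y) \<oplus> y" using *(1,2) by algebra
      ultimately show "\<exists>n\<in>PI (c + (p - 1)). x = n \<oplus> y" by blast
    qed
    finally show "(?N #>\<^bsub>G\<^esub> (x, k) = ?N #>\<^bsub>G\<^esub> (y, l)) = (k = l \<and> x \<ominus> y \<in> PI (c + (p - 1)))"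
      by blast
  qed (use assms in simp)
qed

text \<open>\<open>subgroup_data\<close>, \<open>coords\<close> and \<open>coord_maps\<close> are
  defined before c is introduced, so both quotients are presented by the same parameters and the
  same maps; only \<open>elem\<close> differs.\<close>

lemma (in cyclotomic_domain) quillen_stable:
  assumes "i \<ge> p + 1" "j \<ge> p + 1"
  shows "equivalent_categories (quillen_category p (G Mod lower_central G i))
    (quillen_category p (G Mod lower_central G j))"
proof -
  \<comment> \<open>The exponent i - 1 is split as (i - p) + (p - 1), which identifies c as i -
    p.\<close>
  have lc: "lower_central G i = PI ((i - p) + (p - 1)) \<times> {0}" if "i \<ge> p + 1" for i
    using lower_central_eq[of "i - 2"] that p_gt_1
    by (simp add: numeral_2_eq_2 Suc_diff_Suc del: lower_central.simps)
  have pos: "i - p > 0" "j - p > 0" using assms by auto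
  interpret I: cyclotomic_quotient R p \<theta> "G Mod (PI ((i - p) + (p - 1)) \<times> {0::int})"
    "\<lambda>g. (PI ((i - p) + (p - 1)) \<times> {0::int}) #>\<^bsub>G\<^esub> g" "i - p"
    by (rule cyclotomic_quotient_Mod[OF pos(1)])
  interpret J: cyclotomic_quotient R p \<theta> "G Mod (PI ((j - p) + (p - 1)) \<times> {0::int})"
    "\<lambda>g. (PI ((j - p) + (p - 1)) \<times> {0::int}) #>\<^bsub>G\<^esub> g" "j - p"
    by (rule cyclotomic_quotient_Mod[OF pos(2)])
  show ?thesis
    unfolding lc[OF assms(1)] lc[OF assms(2)]
  proof (rule quillen_equivalentI[where e = I.elem and e' = J.elem and M = coord_maps])
    fix t a b assume *: "t \<in> subgroup_data" "a \<in> coords t" "b \<in> coords t"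
    then obtain x S K s k s' k' where "t = (x, S, K)" "a = (s, k)" "b = (s', k')"
      "s \<in> S" "k \<in> K" "s' \<in> S" "k' \<in> K"
      by (cases t) (auto simp: coords_def)
    then show "I.elem t a = I.elem t b \<longleftrightarrow> J.elem t a = J.elem t b"
      using I.elem_eq_iff J.elem_eq_iff *(1) by metis
  qed (use I.group_H J.group_H I.objects J.objects I.morphism_iff J.morphism_iff coord_maps_coords in auto)
qed

theorem lemma8p1:
  fixes p i j :: nat
    and L :: "'l ring"
    and \<iota> :: "((nat \<Rightarrow> int) \<times> (nat \<Rightarrow> int)) set \<Rightarrow> 'l"
    and \<theta> :: 'l
    and \<O> :: "'l set"
    and G :: "('l \<times> int) monoid"
  assumes "Factorial_Ring.prime p" and "odd p"
    and "field L" and "\<iota> \<in> ring_hom (padic_field p) L"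
    and "primitive_root_of_unity L p \<theta>"
    and "\<O> = ring.simple_extension L (\<iota> ` padic_integers p) \<theta>"
    and "G = semidirect_product (add_monoid (L\<lparr>carrier := \<O>\<rparr>)) (integer_mod_group p)
               (\<lambda>k x. \<theta> [^]\<^bsub>L\<^esub> nat k \<otimes>\<^bsub>L\<^esub> x)"
    and "i \<ge> p + 1" and "j \<ge> p + 1"
  shows "equivalent_categories (quillen_category p (G Mod lower_central G i))
                               (quillen_category p (G Mod lower_central G j))"
proof -
  interpret L: field L by fact
  let ?R = "L\<lparr>carrier := \<O>\<rparr>"
  have \<theta>: "\<theta> \<in> carrier L" "\<theta> [^]\<^bsub>L\<^esub> p = \<one>\<^bsub>L\<^esub>" "\<theta> \<noteq> \<one>\<^bsub>L\<^esub>"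
  proof -
    \<comment> \<open>Primitivity is applied with exponent 1, which is below p.\<close>
    have "\<theta> [^]\<^bsub>L\<^esub> (1::nat) \<noteq> \<one>\<^bsub>L\<^esub>" "\<theta> \<in> carrier L"
      using assms(1,5) prime_gt_1_nat[of p] unfolding primitive_root_of_unity_def by auto
    then show "\<theta> \<noteq> \<one>\<^bsub>L\<^esub>" by auto
  qed (use assms(5) in \<open>simp_all add: primitive_root_of_unity_def\<close>)
  have Z: "subring (\<iota> ` padic_integers p) L"
    by (rule padic_integers_image_subring[OF assms(1) L.ring_axioms assms(4)])
  have "domain ?R"
    using L.subdomain_is_domain[OF L.subdomainI'[OF L.simple_extension_is_subring[OF Z \<theta>(1)]]]
    by (simp add: assms(6))
  moreover have "\<theta> \<in> \<O>"
    using L.simple_extension_mem[OF Z \<theta>(1)] by (simp add: assms(6))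
  \<comment> \<open>As a subring of the field L, the ring \<O> is a domain; powers of \<theta> in
    \<O> and in L coincide, so the relation for \<theta> and the action defining G carry
    over.\<close>
  ultimately interpret cyclotomic_domain ?R p \<theta>
    using assms(1) \<theta> by (simp add: cyclotomic_domain_def cyclotomic_domain_axioms_def
        flip: L.nat_pow_consistent)
  have "cyclotomic_domain.G ?R p \<theta> = G"
    unfolding G_def assms(7) by (simp flip: L.nat_pow_consistent)
  then show ?thesis
    using quillen_stable[OF assms(8,9)] by simp
qed

end
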